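(* There exists a constant $C>0$ such that for all integers $n\ge2$ and $\ell$ with $1\le\ell<n$, there exists an $\ell$-covering set of $\mathbb{Z}_n$ of size at most $C\,\frac{n\log n}{\ell}$; that is, $f(n,\ell)\le C\,\frac{n\log n}{\ell}$.
   Context: For integers $n\ge 2$ and $\ell\ge0$, a set $B\subseteq\mathbb{Z}_n$ is an $\ell$-covering set if $\{ab\bmod n: 0\le a\le\ell,\ b\in B\}=\mathbb{Z}_n$, and $f(n,\ell)$ is the minimum size of an $\ell$-covering set of $\mathbb{Z}_n$. Convention: $\log x$ denotes $\max(\ln x,1)$. *)

theory Defs
  imports Complex_Main
begin

definition covering_set :: "nat \<Rightarrow> nat \<Rightarrow> nat set \<Rightarrow> bool" where
  "covering_set n l B \<longleftrightarrow> B \<subseteq> {..<n} \<and>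
     {(a * b) mod n | a b. a \<le> l \<and> b \<in> B} = {..<n}"

definition f_cov :: "nat \<Rightarrow> nat \<Rightarrow> nat" where
  "f_cov n l = (LEAST k. \<exists>B. covering_set n l B \<and> card B = k)"

text \<open>Convention: log x denotes max(ln x, 1).\<close>
definition logc :: "real \<Rightarrow> real" where
  "logc x = max (ln x) 1"

end

theory Submission
  imports Defs "HOL-Number_Theory.Number_Theory" "HOL-Real_Asymp.Real_Asymp"
begin

text \<open>
  If every \<open>x\<close> is covered by at least \<open>N\<close> elements \<open>b\<close> of a set \<open>I\<close>, then the greedy algorithm
  covers everything with about \<open>card I / N * ln l + n / l\<close> elements. Let \<open>d = gcd x n\<close>.

  For \<open>l\<close> below \<open>8 * ln n\<close> one takes all of \<open>\<int>/n\<close>. For somewhat larger \<open>l\<close>, with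
  \<open>(ln l)\<^sup>2 \<le> ln n\<close>, the primes \<open>a \<le> l\<close> not dividing \<open>n\<close> give \<open>N\<close> of order \<open>l / ln l\<close> by
  Chebyshev's bound, and the greedy factor \<open>ln l\<close> is affordable twice.

  For large \<open>l\<close> take for \<open>I\<close> the units modulo \<open>n\<close>. They act transitively on the \<open>x\<close> with given
  \<open>d\<close>, so the proportion of units covering \<open>x\<close> is the number of \<open>a \<le> l / d\<close> coprime to \<open>n / d\<close>
  divided by \<open>totient (n / d)\<close>, and this is at least \<open>l / (2 * n)\<close> by a sieve as long as \<open>d\<close> is not
  too close to \<open>l\<close>. The remaining \<open>x\<close> have a large \<open>d\<close>. There are few of them since the sum of
  \<open>1 / d\<close> over large divisors of \<open>n\<close> is small. Those of additive order \<open>n / d > l\<close> are covered by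
  the greedy algorithm with multipliers coprime to \<open>n\<close>, and those with \<open>n / d \<le> l\<close> by \<open>b = d\<close>.
  When \<open>n / l\<close> is so small that the number of these \<open>d\<close> is not negligible, one instead splits off from
  \<open>n\<close> about \<open>ln n\<close> or fewer factors \<open>e \<ge> n / l\<close> such that every large \<open>d\<close> is a multiple of one
  of them.
\<close>

section \<open>A sieve for integers coprime to n\<close>

text \<open>The largest element of \<open>A\<close> is at least \<open>card A\<close>, so peeling
  off maxima replaces the \<open>i\<close>-th smallest element by \<open>i\<close>, which can only
  increase the value of a decreasing \<open>f\<close>.\<close>

lemma sum_antimono_le_sum_atLeast1:
  fixes f :: "nat \<Rightarrow> real"
  assumes "finite A" "0 \<notin> A" "\<And>i j. 1 \<le> i \<Longrightarrow> i \<le> j \<Longrightarrow> f j \<le> f i"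
  shows "sum f A \<le> sum f {1..card A}"
  using assms(1,2)
proof (induction "card A" arbitrary: A)
  case 0
  then show ?case by simp
next
  case (Suc k)
  define M where "M = Max A"
  have "A \<noteq> {}" using Suc by auto
  then have M: "M \<in> A" "\<And>a. a \<in> A \<Longrightarrow> a \<le> M"
    using Suc by (auto simp: M_def)
  have "A \<subseteq> {1..M}" using M Suc.prems by (auto simp: Suc_le_eq intro: gr0I)
  then have "card A \<le> M" using card_mono[of "{1..M}" A] by simp
  have c: "card (A - {M}) = k" using Suc M by simp
  have "sum f (A - {M}) \<le> sum f {1..k}"
    using Suc.hyps(1)[of "A - {M}"] c Suc.prems by auto
  moreover have "f M \<le> f (Suc k)" using \<open>card A \<le> M\<close> Suc.hyps(2) assms(3) by simp
  moreover have "sum f A = f M + sum f (A - {M})" using M Suc.prems by (simp add: sum.remove)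
  ultimately show ?case using Suc.hyps(2)[symmetric] by simp
qed

text \<open>Comparison with the integral of \<open>x powr (-3/4)\<close>; in terms of fourth roots
  the induction step is \<open>1 = u^4 - v^4 \<le> 4 * u^3 * (u - v)\<close>.\<close>

lemma sum_inverse_powr_le:
  "(\<Sum>k=1..w. real k powr (-3/4)) \<le> 4 * real w powr (1/4)"
proof (induction w)
  case 0
  then show ?case by simp
next
  case (Suc w)
  define u v where "u = real (Suc w) powr (1/4)" and "v = real w powr (1/4)"
  have u: "u > 0" and v: "v \<ge> 0" and uv: "v \<le> u" 
    by (auto simp: u_def v_def intro: powr_mono2)
  have u4: "u ^ 4 = real (Suc w)" by (simp add: u_def powr_power)
  have v4: "v ^ 4 = real w" by (cases "w = 0") (simp_all add: v_def powr_power)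
  have u3: "real (Suc w) powr (-3/4) = 1 / u ^ 3"
    unfolding u_def by (simp add: powr_power powr_minus_divide)
  have "1 = (u - v) * (u^3 + u^2*v + u*v^2 + v^3)"
    using u4 v4 by (simp add: algebra_simps power4_eq_xxxx power3_eq_cube power2_eq_square)
  also have "\<dots> \<le> (u - v) * (4 * u^3)"
  proof (rule mult_left_mono)
    have "u^2*v \<le> u^2*u" using u uv by (intro mult_left_mono) auto
    moreover have "u*v^2 \<le> u*u^2" using u uv v by (intro mult_left_mono power_mono) auto
    moreover have "v^3 \<le> u^3" using u uv v by (intro power_mono) auto
    ultimately show "u^3 + u^2*v + u*v^2 + v^3 \<le> 4 * u^3"
      by (simp add: power3_eq_cube power2_eq_square)
  qed (use uv in auto)
  finally have "1 / u^3 \<le> 4 * u - 4 * v" using u by (simp add: field_simps)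
  then show ?case using Suc u3 by (simp add: u_def v_def)
qed

lemma power4_powr_quarter: "(x ^ 4) powr (1/4) = x" if "x > 0" for x :: real
  using powr_powr[of x 4 "1/4"] that by simp

text \<open>By \<open>1 + x \<le> exp x\<close> only the sum of the powers matters, and for given
  cardinality it is largest on an initial segment.\<close>

lemma prod_one_plus_prime_powr_le:
  fixes A :: "nat set"
  assumes "finite A" "0 \<notin> A" "c \<ge> 0"
  shows "(\<Prod>p\<in>A. 1 + c * real p powr (-3/4)) \<le> exp (4 * c * real (card A) powr (1/4))"
proof -
  have "(\<Prod>p\<in>A. 1 + c * real p powr (-3/4)) \<le> (\<Prod>p\<in>A. exp (c * real p powr (-3/4)))"
    using assms by (intro prod_mono) auto
  also have "\<dots> = exp (c * (\<Sum>p\<in>A. real p powr (-3/4)))"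
    using assms by (simp add: exp_sum sum_distrib_left)
  also have "\<dots> \<le> exp (c * (4 * real (card A) powr (1/4)))"
  proof -
    have "(\<Sum>p\<in>A. real p powr (-3/4)) \<le> (\<Sum>k=1..card A. real k powr (-3/4))"
      using assms by (intro sum_antimono_le_sum_atLeast1) (auto intro: powr_mono2')
    also have "\<dots> \<le> 4 * real (card A) powr (1/4)" by (rule sum_inverse_powr_le)
    finally show ?thesis using assms by (simp add: mult_left_mono)
  qed
  finally show ?thesis by (simp add: mult_ac)
qed

text \<open>The extreme case is \<open>{2..card A + 1}\<close>, where the product
  telescopes.\<close>

lemma prod_one_minus_inverse_ge:
  fixes A :: "nat set"
  assumes "finite A" "\<And>a. a \<in> A \<Longrightarrow> a \<ge> 2"
  shows "1 / (real (card A) + 1) \<le> (\<Prod>p\<in>A. 1 - 1 / real p)"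
  using assms
proof (induction "card A" arbitrary: A)
  case 0
  then show ?case by simp
next
  case (Suc k)
  define M where "M = Max A"
  have "A \<noteq> {}" using Suc by auto
  then have M: "M \<in> A" "\<And>a. a \<in> A \<Longrightarrow> a \<le> M"
    using Suc by (auto simp: M_def)
  have "A \<subseteq> {2..M}" using M Suc.prems by auto
  then have "card A \<le> M - 1" using card_mono[of "{2..M}" A] by simp
  then have M2: "k + 2 \<le> M" using Suc.hyps(2) by simp
  have c: "card (A - {M}) = k" using Suc M by simp
  have "1 / (real k + 1) \<le> (\<Prod>p\<in>A - {M}. 1 - 1 / real p)"
    using Suc.hyps(1)[of "A - {M}"] c Suc.prems by auto
  moreover have "(real k + 1) / (real k + 2) \<le> 1 - 1 / real M"
    using M2 by (simp add: field_simps)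
  ultimately have "(real k + 1) / (real k + 2) * (1 / (real k + 1)) \<le>
      (1 - 1 / real M) * (\<Prod>p\<in>A - {M}. 1 - 1 / real p)"
    using M2 by (intro mult_mono) auto
  moreover have "(\<Prod>p\<in>A. 1 - 1 / real p) = (1 - 1 / real M) * (\<Prod>p\<in>A - {M}. 1 - 1 / real p)" 
    using M Suc.prems by (simp add: prod.remove)
  ultimately show ?case using Suc.hyps(2)[symmetric] by (simp add: add_ac)
qed

text \<open>The length \<open>y\<close> is real because sieving by a further prime \<open>p\<close>
  leads to the length \<open>y / p\<close>.\<close>

definition sifted :: "real \<Rightarrow> nat set \<Rightarrow> nat set" where
  "sifted y S = {a. 0 < a \<and> real a \<le> y \<and> (\<forall>p\<in>S. \<not> p dvd a)}"

lemma finite_sifted [simp]: "finite (sifted y S)"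
  by (rule finite_subset[of _ "{..nat \<lfloor>y\<rfloor>}"]) (auto simp: sifted_def le_nat_floor)

text \<open>Legendre's recursion: the new prime removes exactly the numbers \<open>p * a\<close>
  with \<open>a\<close> in the sifted set of length \<open>y / p\<close>, since no prime of
  \<open>S\<close> divides \<open>p\<close>.\<close>

lemma card_sifted_insert:
  assumes "prime p" "p \<notin> S" "\<And>q. q \<in> S \<Longrightarrow> prime q"
  shows "card (sifted y S) = card (sifted y (insert p S)) + card (sifted (y / real p) S)"
proof -
  have p0: "p > 0" using assms(1) by (simp add: prime_gt_0_nat)
  have qp: "q dvd p * a \<longleftrightarrow> q dvd a" if "q \<in> S" for q a
    using that assms by (metis prime_dvd_mult_iff primes_dvd_imp_eq)
  have "sifted y S = sifted y (insert p S) \<union> (*) p ` sifted (y / real p) S"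
  proof (intro equalityI subsetI)
    fix a assume a: "a \<in> sifted y S"
    show "a \<in> sifted y (insert p S) \<union> (*) p ` sifted (y / real p) S"
    proof (cases "p dvd a")
      case True
      then obtain b where "a = p * b" by auto
      with a p0 qp show ?thesis by (auto simp: sifted_def field_simps)
    qed (use a in \<open>auto simp: sifted_def\<close>)
  qed (use p0 qp in \<open>auto simp: sifted_def field_simps\<close>)
  moreover have "sifted y (insert p S) \<inter> (*) p ` sifted (y / real p) S = {}"
    by (auto simp: sifted_def)
  moreover have "inj_on ((*) p) (sifted (y / real p) S)"
    using p0 by (auto simp: inj_on_def)
  ultimately show ?thesis by (simp add: card_Un_disjoint card_image)
qed

text \<open>The exponent 3/4 is available because the error of the empty sieve is at most
  \<open>min 1 y\<close>, and it makes the error terms of the Legendre recursion summable.\<close>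

lemma card_sifted_approx:
  assumes "finite S" "\<And>q. q \<in> S \<Longrightarrow> prime q" "y \<ge> 0"
  shows "\<bar>real (card (sifted y S)) - y * (\<Prod>p\<in>S. 1 - 1 / real p)\<bar>
           \<le> y powr (3/4) * (\<Prod>p\<in>S. 1 + real p powr (-3/4))"
  using assms
proof (induction S arbitrary: y rule: finite_induct)
  case empty
  have "sifted y {} = {1..nat \<lfloor>y\<rfloor>}"
    using empty by (auto simp: sifted_def le_nat_floor le_nat_iff le_floor_iff)
  then have c: "real (card (sifted y {})) = of_int \<lfloor>y\<rfloor>" using empty by simp
  show ?case
  proof (cases "y \<ge> 1")
    case True
    have "\<bar>of_int \<lfloor>y\<rfloor> - y\<bar> \<le> 1" by linarith
    also have "1 \<le> y powr (3/4)" using True by (simp add: ge_one_powr_ge_zero)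
    finally show ?thesis using c by simp
  next
    case False
    then have "\<lfloor>y\<rfloor> = 0" using empty by linarith
    moreover have "y powr 1 \<le> y powr (3/4)" 
      using False empty by (intro powr_mono') auto
    ultimately show ?thesis using c empty by simp
  qed
next
  case (insert p S)
  have p: "prime p" "p > 0" using insert.prems(1)[of p] by (auto simp: prime_gt_0_nat)
  have IH: "\<bar>real (card (sifted y S)) - y * (\<Prod>p\<in>S. 1 - 1 / real p)\<bar>
           \<le> y powr (3/4) * (\<Prod>p\<in>S. 1 + real p powr (-3/4))" if "y \<ge> 0" for y
    using insert that by auto
  define V R where "V = (\<Prod>p\<in>S. 1 - 1 / real p)" and "R = (\<Prod>p\<in>S. 1 + real p powr (-3/4))"
  have c: "real (card (sifted y (insert p S))) =
      real (card (sifted y S)) - real (card (sifted (y / real p) S))"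
    using card_sifted_insert[of p S y] insert p by auto
  have pw: "(y / real p) powr (3/4) = y powr (3/4) * real p powr (-3/4)"
    using insert.prems p by (simp add: powr_divide powr_minus_divide)
  have 1: "\<bar>real (card (sifted y S)) - y * V\<bar> \<le> y powr (3/4) * R"
    using IH insert.prems by (simp add: V_def R_def)
  have 2: "\<bar>real (card (sifted (y / real p) S)) - y / real p * V\<bar> 
      \<le> y powr (3/4) * real p powr (-3/4) * R"
    using IH[of "y / real p"] insert.prems by (simp add: V_def R_def pw)
  have 3: "y * (\<Prod>p\<in>insert p S. 1 - 1 / real p) = y * V - y / real p * V"
    using insert.hyps by (simp add: V_def algebra_simps)
  have 4: "y powr (3/4) * (\<Prod>p\<in>insert p S. 1 + real p powr (-3/4)) =
      y powr (3/4) * R + y powr (3/4) * real p powr (-3/4) * R"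
    using insert.hyps by (simp add: R_def algebra_simps)
  have "\<bar>a - c - (b - d)\<bar> \<le> e + f" if "\<bar>a - b\<bar> \<le> e" "\<bar>c - d\<bar> \<le> f" for a b c d e f :: real
    using that by linarith
  from this[OF 1 2] show ?case unfolding c 3 4 .
qed

lemma prime_factors_dvd_subset:
  "m dvd n \<Longrightarrow> n > 0 \<Longrightarrow> prime_factors m \<subseteq> prime_factors (n::nat)"
  by (simp add: dvd_prime_factors)

text \<open>\<open>H = sieve_bound n\<close> dominates both the relative error of sieving by the primes dividing \<open>n\<close>
  (the factor \<open>w + 1\<close> bounds \<open>n / totient n\<close>) and the sum of \<open>d powr (-3/4)\<close> over the divisors \<open>d\<close>
  of \<open>n\<close>. The fourth power \<open>H ^ 4\<close> is thus the length from which on the sieve is effective.\<close>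

definition sieve_bound :: "nat \<Rightarrow> real" where
  "sieve_bound n = (let w = real (card (prime_factors n)) in 2 * (w + 1) * exp (10 * w powr (1/4)))"

lemma sieve_bound_ge_2: "sieve_bound n \<ge> 2"
proof -
  define w where "w = real (card (prime_factors n))"
  have "2 * 1 * (1::real) \<le> 2 * (w + 1) * exp (10 * w powr (1/4))"
    by (intro mult_mono) (auto simp: w_def)
  then show ?thesis by (simp add: sieve_bound_def w_def Let_def)
qed

lemma totient_ratio_ge:
  assumes "n > 0"
  shows "real (totient n) / real n \<ge> 1 / (real (card (prime_factors n)) + 1)"
proof -
  have "1 / (real (card (prime_factors n)) + 1) \<le> (\<Prod>p\<in>prime_factors n. 1 - 1 / real p)"
    by (rule prod_one_minus_inverse_ge) (auto simp: prime_factors_dvd prime_ge_2_nat in_prime_factors_iff)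
  then show ?thesis using assms totient_formula2[of n] by simp
qed

text \<open>The main term of the sieve is at least \<open>y / (w + 1)\<close>, the error at most
  \<open>y powr (3/4) * exp (10 * w powr (1/4))\<close>. As \<open>y powr (1/4)\<close> is at least
  \<open>sieve_bound n\<close>, the error is at most half the main term. Bounding by the primes of
  \<open>n\<close> makes one threshold serve all divisors \<open>m\<close>.\<close>

lemma card_coprime_ge:
  assumes "m dvd n" "n > 0" "y \<ge> sieve_bound n ^ 4"
  shows "real (card {a. 0 < a \<and> real a \<le> y \<and> coprime a m}) \<ge> y * (real (totient m) / real m) / 2"
proof -
  define S where "S = prime_factors m"
  define w where "w = real (card (prime_factors n))"
  have m: "m > 0" using assms by (auto intro: gr0I)
  have S: "finite S" "\<And>q. q \<in> S \<Longrightarrow> prime q" by (auto simp: S_def)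
  have cw: "real (card S) \<le> w"
    unfolding S_def w_def using prime_factors_dvd_subset[OF assms(1,2)] by (simp add: card_mono)
  have y: "y > 0" using assms(3) sieve_bound_ge_2[of n] by (smt (verit) zero_less_power)
  have eq: "{a. 0 < a \<and> real a \<le> y \<and> coprime a m} = sifted y S"
  proof -
    have "coprime a m \<longleftrightarrow> (\<forall>p\<in>S. \<not> p dvd a)" if "a > 0" for a
      using m that unfolding S_def
      by (metis coprime_common_divisor gcd_nat.bounded_iff in_prime_factors_iff neq0_conv
          not_prime_unit order_refl prime_factor_nat coprime_iff_gcd_eq_1)
    then show ?thesis by (auto simp: sifted_def)
  qed
  have V: "(\<Prod>p\<in>S. 1 - 1 / real p) = real (totient m) / real m"
    using totient_formula2[of m] m by (simp add: S_def)
  have "(\<Prod>p\<in>S. 1 + real p powr (-3/4)) \<le> exp (4 * real (card S) powr (1/4))"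
    using prod_one_plus_prime_powr_le[of S 1] S(1) S(2)[of 0] by auto
  also have "\<dots> \<le> exp (10 * w powr (1/4))"
  proof -
    have "real (card S) powr (1/4) \<le> w powr (1/4)" using cw by (intro powr_mono2) auto
    moreover have "w powr (1/4) \<ge> 0" by simp
    ultimately show ?thesis by (simp del: powr_ge_zero)
  qed
  finally have R: "(\<Prod>p\<in>S. 1 + real p powr (-3/4)) \<le> exp (10 * w powr (1/4))" .
  have y4: "sieve_bound n \<le> y powr (1/4)"
  proof -
    have "sieve_bound n = (sieve_bound n ^ 4) powr (1/4)" using sieve_bound_ge_2[of n]
      by (simp add: power4_powr_quarter)
    also have "\<dots> \<le> y powr (1/4)" using assms(3) sieve_bound_ge_2[of n] by (intro powr_mono2) auto
    finally show ?thesis .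
  qed
  have yy: "y = y powr (3/4) * y powr (1/4)" using y by (simp flip: powr_add)
  have "y powr (3/4) * (\<Prod>p\<in>S. 1 + real p powr (-3/4)) \<le> y powr (3/4) * exp (10 * w powr (1/4))"
    using R by (intro mult_left_mono) auto
  also have "\<dots> = y powr (3/4) * sieve_bound n / (2 * (w + 1))"
    by (simp add: sieve_bound_def w_def Let_def)
  also have "\<dots> \<le> y powr (3/4) * y powr (1/4) / (2 * (w + 1))"
    using y4 by (intro divide_right_mono mult_left_mono) (auto simp: w_def)
  also have "\<dots> = y * (1 / (w + 1)) / 2" by (simp flip: yy)
  also have "\<dots> \<le> y * (real (totient m) / real m) / 2"
  proof -
    have "1 / (w + 1) \<le> 1 / (real (card S) + 1)" using cw by (simp add: frac_le)
    also have "\<dots> \<le> real (totient m) / real m" using totient_ratio_ge[OF m] by (simp add: S_def)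
    finally show ?thesis using y by (intro divide_right_mono mult_left_mono) auto
  qed
  finally show ?thesis
    using card_sifted_approx[of S y] S y unfolding eq V by force
qed

section \<open>Sums over the divisors of \<open>n\<close>\<close>

text \<open>The sum is at most the Euler product of \<open>1 / (1 - p powr (-3/4))\<close>. The
  proof sifts the primes out of the divisors one at a time.\<close>

lemma sum_divisors_powr_le:
  assumes "n > 0"
  shows "(\<Sum>d | d dvd n. real d powr (-3/4)) \<le> exp (10 * real (card (prime_factors n)) powr (1/4))"
proof -
  define g where "g = (\<lambda>d::nat. real d powr (-3/4))"
  define A where "A = (\<lambda>S. {d. d dvd n \<and> (\<forall>p\<in>S. \<not> p dvd d)})"
  have finA: "finite (A S)" for S
    by (rule finite_subset[OF _ finite_divisors_nat[OF assms]]) (auto simp: A_def)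
  \<comment> \<open>For \<open>g \<ge> 0\<close>, \<open>(1 + 5/2 * g) * (1 - g) \<ge> 1\<close>
    holds exactly when \<open>g \<le> 3/5\<close>, and the largest value
    \<open>2 powr (-3/4)\<close> is just below that. The \<open>5/2\<close> leads to the constant
    \<open>10 = 4 * (5/2)\<close> in the exponent.\<close>
  have x: "0 < 1 - g p" "1 \<le> (1 + 5/2 * g p) * (1 - g p)" if "prime p" for p
  proof -
    have p: "p \<ge> 2" using that prime_ge_2_nat by auto
    have "g p \<le> 2 powr (-3/4)" unfolding g_def using p by (intro powr_mono2') auto
    moreover have "(2::real) powr (-3/4) \<le> 3/5"
    proof -
      have "(2::real) powr (-3/4) = (1/8) powr (1/4)"
        using powr_powr[of "2::real" 3 "1/4"] by (simp add: powr_divide powr_minus_divide)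
      also have "\<dots> \<le> ((3/5)^4) powr (1/4)" by (intro powr_mono2) (auto simp: power_divide)
      also have "\<dots> = 3/5" by (simp add: power4_powr_quarter)
      finally show ?thesis .
    qed
    ultimately have b: "g p \<le> 3/5" by simp
    have "g p \<ge> 0" by (simp add: g_def)
    then have "g p * (3/2 - 5/2 * g p) \<ge> 0" using b by (intro mult_nonneg_nonneg) auto
    then show "0 < 1 - g p" "1 \<le> (1 + 5/2 * g p) * (1 - g p)" using b by (auto simp: algebra_simps)
  qed
  have *: "sum g (A {}) \<le> (\<Prod>p\<in>S. 1 + 5/2 * g p) * sum g (A S)"
    if "finite S" "\<And>p. p \<in> S \<Longrightarrow> prime p" for S
    using that
  proof (induction S rule: finite_induct)
    case empty
    then show ?case by simp
  next
    case (insert p S)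
    have p: "prime p" "p > 0" using insert.prems[of p] by (auto simp: prime_gt_0_nat)
    \<comment> \<open>Dividing by \<open>p\<close> once stays inside \<open>A S\<close>, so the
      multiples of \<open>p\<close> contribute at most \<open>g p\<close> times the whole
      sum.\<close>
    have sub: "{d \<in> A S. p dvd d} \<subseteq> (*) p ` A S"
    proof
      fix d assume d: "d \<in> {d \<in> A S. p dvd d}"
      then obtain c where c: "d = p * c" by auto
      then have "c \<in> A S" using d by (auto simp: A_def intro: dvd_trans)
      then show "d \<in> (*) p ` A S" using c by auto
    qed
    have "sum g (A S) = sum g (A (insert p S)) + sum g {d \<in> A S. p dvd d}"
    proof -
      have "A S = A (insert p S) \<union> {d \<in> A S. p dvd d}" "A (insert p S) \<inter> {d \<in> A S. p dvd d} = {}"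
        by (auto simp: A_def)
      then show ?thesis using finA sum.union_disjoint[of "A (insert p S)" "{d \<in> A S. p dvd d}" g] by simp
    qed
    also have "sum g {d \<in> A S. p dvd d} \<le> sum g ((*) p ` A S)"
      using sub finA by (intro sum_mono2) (auto simp: g_def)
    also have "\<dots> = g p * sum g (A S)"
      using p by (subst sum.reindex) (auto simp: inj_on_def g_def sum_distrib_left powr_mult)
    finally have 1: "(1 - g p) * sum g (A S) \<le> sum g (A (insert p S))" by (simp add: algebra_simps)
    have g0: "sum g (A S) \<ge> 0" "g p \<ge> 0" by (auto simp: g_def intro: sum_nonneg)
    have "sum g (A S) \<le> (1 + 5/2 * g p) * (1 - g p) * sum g (A S)"
      using mult_right_mono[OF x(2)[OF p(1)] g0(1)] by simp
    also have "\<dots> \<le> (1 + 5/2 * g p) * sum g (A (insert p S))"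
      using 1 g0 by (simp add: mult_left_mono mult.assoc)
    finally have 2: "sum g (A S) \<le> (1 + 5/2 * g p) * sum g (A (insert p S))" .
    have "sum g (A {}) \<le> (\<Prod>p\<in>S. 1 + 5/2 * g p) * sum g (A S)" using insert by auto
    also have "\<dots> \<le> (\<Prod>p\<in>S. 1 + 5/2 * g p) * ((1 + 5/2 * g p) * sum g (A (insert p S)))"
      using 2 by (intro mult_left_mono prod_nonneg) (auto simp: g_def)
    finally show ?case using insert.hyps by (simp add: mult_ac)
  qed
  have "A (prime_factors n) = {1}"
  proof -
    have "d = 1" if "d dvd n" "\<forall>p\<in>prime_factors n. \<not> p dvd d" for d
      using that assms by (metis dvd_trans in_prime_factors_iff neq0_conv prime_factor_nat)
    then show ?thesis by (auto simp: A_def in_prime_factors_iff)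
  qed
  then have "sum g (A {}) \<le> (\<Prod>p\<in>prime_factors n. 1 + 5/2 * g p)"
    using *[of "prime_factors n"] by (auto simp: g_def)
  also have "\<dots> \<le> exp (4 * (5/2) * real (card (prime_factors n)) powr (1/4))"
    unfolding g_def by (rule prod_one_plus_prime_powr_le) (auto simp: in_prime_factors_iff)
  finally show ?thesis by (simp add: A_def g_def)
qed

section \<open>Greedy covers\<close>

definition multiples :: "nat \<Rightarrow> nat \<Rightarrow> nat \<Rightarrow> nat set" where
  "multiples n l b = {(a * b) mod n | a. a \<le> l}"

text \<open>The target \<open>U\<close> is a parameter so that covers of different pieces can be
  joined.\<close>

definition covers :: "nat \<Rightarrow> nat \<Rightarrow> nat set \<Rightarrow> nat set \<Rightarrow> bool" where
  "covers n l B U \<longleftrightarrow> B \<subseteq> {..<n} \<and> U \<subseteq> (\<Union>b\<in>B. multiples n l b)"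

lemma covers_Un: "covers n l B U \<Longrightarrow> covers n l B' U' \<Longrightarrow> covers n l (B \<union> B') (U \<union> U')"
  by (auto simp: covers_def)

lemma covers_mono: "covers n l B U \<Longrightarrow> U' \<subseteq> U \<Longrightarrow> covers n l B U'"
  by (auto simp: covers_def)

lemma covers_imp_covering_set: "covers n l B {..<n} \<Longrightarrow> n > 0 \<Longrightarrow> covering_set n l B"
  unfolding covering_set_def covers_def multiples_def by force

lemma self_in_multiples: "x < n \<Longrightarrow> 1 \<le> l \<Longrightarrow> x \<in> multiples n l x"
  unfolding multiples_def by (auto intro!: exI[of _ 1])

text \<open>The multiplier \<open>x / b\<close> is below \<open>n / b \<le> l\<close>, and no
  reduction modulo \<open>n\<close> takes place.\<close>

lemma dvd_in_multiples:
  assumes "b dvd x" "x < n" "n \<le> l * b"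
  shows "x \<in> multiples n l b"
proof -
  obtain a where a: "x = b * a" using assms(1) by auto
  have "b * a < b * l" using assms(2,3) unfolding a by (metis le_trans linorder_not_le mult.commute)
  then have "a \<le> l" by simp
  then show ?thesis using a assms(2) by (auto simp: multiples_def intro!: exI[of _ a] simp: mult.commute)
qed

text \<open>Double counting of pairs: as each uncovered element lies in at least \<open>N\<close> of
  the sets, some single set contains a proportion \<open>N / card I\<close> of what is left.\<close>

lemma greedy_partial_cover:
  fixes N :: real
  assumes "finite U" "finite I" "N \<ge> 0" "\<And>x. x \<in> U \<Longrightarrow> N \<le> real (card {b\<in>I. x \<in> M b})"
    "N \<le> real (card I)" "card I > 0"
  shows "\<exists>B\<subseteq>I. card B \<le> k \<and> real (card (U - (\<Union>b\<in>B. M b))) \<le> real (card U) * (1 - N / real (card I)) ^ k"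
proof (induction k)
  case 0
  then show ?case by (intro exI[of _ "{}"]) auto
next
  case (Suc k)
  then obtain B where B: "B \<subseteq> I" "card B \<le> k"
    "real (card (U - (\<Union>b\<in>B. M b))) \<le> real (card U) * (1 - N / real (card I)) ^ k" by auto
  define R where "R = U - (\<Union>b\<in>B. M b)"
  have finR: "finite R" using assms by (simp add: R_def)
  have "\<exists>b\<in>I. real (card (R \<inter> M b)) * real (card I) \<ge> N * real (card R)"
  proof (rule ccontr)
    assume "\<not> ?thesis"
    then have less: "real (card (R \<inter> M b)) * real (card I) < N * real (card R)" if "b \<in> I" for b
      using that by force
    have "N * real (card R) = (\<Sum>x\<in>R. N)" by simp
    also have "\<dots> \<le> (\<Sum>x\<in>R. real (card {b\<in>I. x \<in> M b}))"
      using assms(4) by (intro sum_mono) (auto simp: R_def)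
    also have "\<dots> = (\<Sum>x\<in>R. \<Sum>b\<in>I. if x \<in> M b then 1 else 0)"
      using assms(2) by (simp add: sum.If_cases Int_def)
    also have "\<dots> = (\<Sum>b\<in>I. \<Sum>x\<in>R. if x \<in> M b then 1 else 0)" by (rule sum.swap)
    also have "\<dots> = (\<Sum>b\<in>I. real (card (R \<inter> M b)))"
      using finR by (simp add: sum.If_cases Int_def)
    finally have "N * real (card R) * real (card I) \<le> (\<Sum>b\<in>I. real (card (R \<inter> M b)) * real (card I))"
      by (simp add: mult_right_mono flip: sum_distrib_right)
    also have "\<dots> < (\<Sum>b\<in>I. N * real (card R))"
      using less assms(2,6) by (intro sum_strict_mono) auto
    finally show False by (simp add: mult_ac)
  qed
  then obtain b where b: "b \<in> I" "real (card (R \<inter> M b)) * real (card I) \<ge> N * real (card R)" by auto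
  have "card R = card (R \<inter> M b) + card (R - M b)"
    using finR by (subst card_Un_disjoint[symmetric]) (auto intro: arg_cong[where f = card])
  then have "real (card (R - M b)) = real (card R) - real (card (R \<inter> M b))" by simp
  also have "\<dots> \<le> real (card R) * (1 - N / real (card I))"
    using b assms(6) by (simp add: field_simps)
  also have "\<dots> \<le> real (card U) * (1 - N / real (card I)) ^ k * (1 - N / real (card I))"
    using B(3) assms(5,6) by (intro mult_right_mono) (auto simp: R_def)
  finally have "real (card (R - M b)) \<le> real (card U) * (1 - N / real (card I)) ^ Suc k"
    by (simp add: mult_ac)
  moreover have "U - (\<Union>b\<in>insert b B. M b) = R - M b" by (auto simp: R_def)
  moreover have "card (insert b B) \<le> Suc k" 
    using B(2) by (metis Suc_le_mono card_insert_le_m1 card_insert_if finite_subset[OF B(1) assms(2)] le_SucI)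
  ultimately show ?case using B(1) b(1) by (intro exI[of _ "insert b B"]) auto
qed

text \<open>The greedy choice is stopped when only \<open>n / l\<close> elements are left, and these are added
  one by one. This costs a factor \<open>ln l\<close> instead of \<open>ln n\<close>, which matters for small \<open>l\<close>.\<close>

lemma greedy_cover:
  fixes N :: real
  assumes "1 \<le> l" "l < n" "U \<subseteq> {..<n}" "I \<subseteq> {..<n}" "N > 0"
    "\<And>x. x \<in> U \<Longrightarrow> N \<le> real (card {b\<in>I. x \<in> multiples n l b})"
  shows "\<exists>B. covers n l B U \<and>
    real (card B) \<le> real (card I) / N * ln (real l) + 2 * real n / real l"
proof (cases "U = {}")
  case True
  then show ?thesis using assms by (intro exI[of _ "{}"]) (auto simp: covers_def)
next
  case False
  have finU: "finite U" and finI: "finite I" using assms(3,4) finite_subset[OF _ finite_lessThan] by blast+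
  from False obtain x where x: "x \<in> U" by auto
  have "card {b\<in>I. x \<in> multiples n l b} \<le> card I" using finI by (intro card_mono) auto
  then have NI: "N \<le> real (card I)" using assms(6)[OF x] by linarith
  then have I0: "card I > 0" using assms(5) by linarith
  \<comment> \<open>With this many steps the remaining proportion is at most
    \<open>exp (- ln l) = 1 / l\<close>.\<close>
  define k where "k = nat \<lceil>real (card I) / N * ln (real l)\<rceil>"
  have lnl: "ln (real l) \<ge> 0" using assms by simp
  have k: "real (card I) / N * ln (real l) \<le> real k" "real k \<le> real (card I) / N * ln (real l) + 1"
    using lnl assms(5) by (auto simp: k_def intro!: real_nat_ceiling_ge) 
  obtain B where B: "B \<subseteq> I" "card B \<le> k"
    "real (card (U - (\<Union>b\<in>B. multiples n l b))) \<le> real (card U) * (1 - N / real (card I)) ^ k"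
    using greedy_partial_cover[OF finU finI _ assms(6) NI I0, of k] assms(5) by auto
  define R where "R = U - (\<Union>b\<in>B. multiples n l b)"
  have "(1 - N / real (card I)) ^ k \<le> exp (- (N / real (card I))) ^ k"
    using NI I0 exp_ge_add_one_self[of "- (N / real (card I))"] by (intro power_mono) auto
  also have "\<dots> = exp (- (real k * N / real (card I)))" by (simp flip: exp_of_nat_mult)
  also have "\<dots> \<le> exp (- ln (real l))"
    using k(1) assms(5) I0 by (simp add: field_simps)
  also have "\<dots> = 1 / real l" using assms by (simp add: exp_minus field_simps)
  finally have e: "(1 - N / real (card I)) ^ k \<le> 1 / real l" .
  have "card U \<le> n" using assms(3) card_mono[of "{..<n}" U] by simp
  then have "real (card U) * (1 - N / real (card I)) ^ k \<le> real n * (1 / real l)"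
    using e NI I0 by (intro mult_mono) auto
  then have R: "real (card R) \<le> real n / real l" using B(3) by (simp add: R_def)
  have "U \<subseteq> (\<Union>b\<in>B \<union> R. multiples n l b)"
  proof
    fix x assume x: "x \<in> U"
    then have "x \<in> multiples n l x" using assms(1,3) by (intro self_in_multiples) auto
    then show "x \<in> (\<Union>b\<in>B \<union> R. multiples n l b)" using x unfolding R_def by (cases "x \<in> R") auto
  qed
  moreover have "B \<union> R \<subseteq> {..<n}" using B(1) assms(3,4) by (auto simp: R_def)
  ultimately have "covers n l (B \<union> R) U" by (simp add: covers_def)
  \<comment> \<open>One \<open>n / l\<close> pays for the leftover elements, the other for rounding
    up \<open>k\<close>.\<close>
  moreover have "1 \<le> real n / real l" using assms by simp
  then have "real (card (B \<union> R)) \<le> real (card I) / N * ln (real l) + 2 * real n / real l"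
    using card_Un_le[of B R] B(2) R k(2) by linarith
  ultimately show ?thesis by blast
qed

section \<open>Units modulo \<open>n\<close> and residues with a given gcd\<close>

text \<open>Take \<open>b = a + k * m\<close> with \<open>k\<close> the product of the primes that
  divide \<open>n\<close> but not \<open>a\<close>. A prime of \<open>n\<close> then divides exactly
  one of \<open>a\<close> and \<open>k * m\<close>.\<close>

lemma coprime_lift:
  fixes a m n :: nat
  assumes "coprime a m" "m dvd n" "n > 0"
  shows "\<exists>b. coprime b n \<and> [b = a] (mod m)"
proof -
  define k where "k = \<Prod>{p \<in> prime_factors n. \<not> p dvd a}"
  have "coprime (a + k * m) n"
  proof (rule ccontr)
    assume "\<not> ?thesis"
    then obtain p where p: "prime p" "p dvd a + k * m" "p dvd n"
      by (metis coprime_iff_gcd_eq_1 gcd_nat.bounded_iff order_refl prime_factor_nat)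
    show False
    proof (cases "p dvd a")
      case True
      then have "p dvd k * m" using p(2) by (simp add: dvd_add_right_iff)
      then consider "p dvd k" | "p dvd m" using p(1) prime_dvd_mult_iff by blast
      then show False
      proof cases
        case 1
        then obtain q where "q \<in> prime_factors n" "\<not> q dvd a" "p dvd q"
          using p(1) by (auto simp: k_def prime_dvd_prod_iff)
        then show False using True p(1) by (metis in_prime_factors_iff primes_dvd_imp_eq)
      next
        case 2
        then show False using True assms(1) p(1) by (metis coprime_common_divisor not_prime_unit)
      qed
    next
      case False
      then have "p dvd k" using p assms(3)
        unfolding k_def by (intro dvd_prodI) (auto simp: in_prime_factors_iff)
      then show False using False p(2) by (simp add: dvd_add_left_iff)
    qed
  qed
  moreover have "[a + k * m = a] (mod m)" for k by (simp add: Cong.cong_def)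
  ultimately show ?thesis by blast
qed

text \<open>After division by the common gcd, \<open>x\<close> and \<open>y\<close> become units
  modulo \<open>m = n / d\<close>; their quotient modulo \<open>m\<close> is lifted to a unit modulo
  \<open>n\<close>.\<close>

lemma gcd_eq_imp_unit_multiple:
  fixes x y n :: nat
  assumes "n > 0" "gcd x n = gcd y n"
  shows "\<exists>u. coprime u n \<and> [u * x = y] (mod n)"
proof -
  define d where "d = gcd x n"
  have d: "d > 0" using assms by (simp add: d_def)
  define m x' y' where "m = n div d" and "x' = x div d" and "y' = y div d"
  have e: "n = d * m" "x = d * x'" "y = d * y'"
    using assms by (auto simp: m_def x'_def y'_def d_def) (metis dvd_mult_div_cancel gcd_dvd1)
  have cop: "coprime x' m" "coprime y' m"
    unfolding x'_def m_def y'_def using assms d_def d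
    by (auto intro: div_gcd_coprime) (metis div_gcd_coprime gcd_eq_0_iff neq0_conv)
  obtain z where z: "[x' * z = 1] (mod m)" using cong_solve_coprime_nat[OF cop(1)] by auto
  have "coprime z m" using cong_imp_coprime[OF cong_sym[OF z]] by simp
  then have "coprime (z * y') m" using cop by simp
  then obtain u where u: "coprime u n" "[u = z * y'] (mod m)"
    using coprime_lift[of "z * y'" m n] e assms(1) by auto
  have "[u * x' = z * y' * x'] (mod m)" using u(2) by (rule cong_scalar_right)
  also have "z * y' * x' = x' * z * y'" by simp
  also have "[\<dots> = 1 * y'] (mod m)" using z by (rule cong_scalar_right)
  finally have "[d * (u * x') = d * y'] (mod d * m)" 
    by (simp add: Cong.cong_def flip: mult_mod_right)
  then show ?thesis using u e by (auto simp: mult_ac)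
qed

lemma gcd_unit_mult:
  fixes u x n :: nat
  assumes "coprime u n"
  shows "gcd (u * x mod n) n = gcd x n"
  using gcd_mult_left_left_cancel[of n u x] assms by (cases "n = 0") (simp_all add: coprime_commute)

text \<open>The units of \<open>\<int>/n\<close> act transitively on the elements with a given gcd \<open>d\<close>, hence each of
  these \<open>totient (n div d)\<close> elements is hit equally often.\<close>

lemma card_units_covering:
  fixes n l x :: nat
  assumes "l < n" "x < n" "x > 0" 
  defines "d \<equiv> gcd x n"
  shows "card {b\<in>{b. b < n \<and> coprime b n}. x \<in> multiples n l b} * totient (n div d) =
         card {b. b < n \<and> coprime b n} * card {a. a \<le> l \<and> 0 < a \<and> gcd a n = d}"
proof -
  define G where "G = {b. b < n \<and> coprime b n}"
  define T where "T = {a. a \<le> l \<and> 0 < a \<and> gcd a n = d}"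
  define Orb where "Orb = {k\<in>{0<..n}. gcd k n = d}"
  have n: "n > 0" and d: "d > 0" using assms by (auto simp: d_def)
  \<comment> \<open>The count by \<open>totient\<close> is over \<open>{0<..n}\<close>; since
    \<open>d \<noteq> n\<close>, the endpoint \<open>n\<close> is not counted and only residues
    below \<open>n\<close> remain.\<close>
  have dn: "d \<noteq> n" using assms by (metis d_def gcd_nat.cobounded1 nat_dvd_not_less)
  then have Orb: "Orb = {k. 0 < k \<and> k < n \<and> gcd k n = d}"
    unfolding Orb_def using n by (auto simp: order_le_less)
  have cOrb: "card Orb = totient (n div d)"
    unfolding Orb_def using n by (intro card_gcd_eq_totient) (auto simp: d_def)
  have fin: "finite G" "finite T" "finite Orb" by (auto simp: G_def T_def Orb_def)
  have mu: "y \<in> multiples n l b \<longleftrightarrow> (\<exists>a\<in>T. a * b mod n = y)" if "b \<in> G" "y \<in> Orb" for b y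
  proof
    assume "y \<in> multiples n l b"
    then obtain a where a: "a \<le> l" "y = a * b mod n" by (auto simp: multiples_def)
    then have "gcd a n = d"
      using that gcd_unit_mult[of b n a] by (auto simp: Orb G_def mult.commute)
    moreover have "a > 0" using a that by (auto simp: Orb intro: gr0I)
    ultimately show "\<exists>a\<in>T. a * b mod n = y" using a by (auto simp: T_def)
  qed (auto simp: multiples_def T_def)
  define c where "c = (\<lambda>y. card {b\<in>G. y \<in> multiples n l b})"
  \<comment> \<open>If \<open>u * y = z\<close> modulo \<open>n\<close>, multiplication by
    \<open>u\<close> injects the units covering \<open>y\<close> into those covering
    \<open>z\<close>.\<close>
  have const: "c y \<le> c z" if "y \<in> Orb" "z \<in> Orb" for y z
  proof -
    obtain u where u: "coprime u n" "[u * y = z] (mod n)"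
      using gcd_eq_imp_unit_multiple[OF n, of y z] \<open>y \<in> Orb\<close> \<open>z \<in> Orb\<close> by (auto simp: Orb_def)
    have z: "z = u * y mod n" using u(2) that(2) by (simp add: Cong.cong_def Orb)
    show ?thesis unfolding c_def
    proof (rule card_inj_on_le[of "\<lambda>b. u * b mod n"])
      show "inj_on (\<lambda>b. u * b mod n) {b \<in> G. y \<in> multiples n l b}"
      proof (rule inj_onI)
        fix b b' assume b: "b \<in> {b \<in> G. y \<in> multiples n l b}" "b' \<in> {b \<in> G. y \<in> multiples n l b}"
          "u * b mod n = u * b' mod n"
        then have "[b = b'] (mod n)" using cong_mult_lcancel_nat[OF u(1), of b b'] by (simp add: Cong.cong_def)
        then show "b = b'" using b by (simp add: Cong.cong_def G_def)
      qed
      show "(\<lambda>b. u * b mod n) ` {b \<in> G. y \<in> multiples n l b} \<subseteq> {b \<in> G. z \<in> multiples n l b}"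
      proof clarify
        fix b assume b: "b \<in> G" "y \<in> multiples n l b"
        then obtain a where a: "a \<le> l" "y = a * b mod n" by (auto simp: multiples_def)
        have "coprime (u * b mod n) n" using b(1) u(1) n by (simp add: G_def)
        then have "u * b mod n \<in> G" using n by (simp add: G_def)
        moreover have "z = a * (u * b mod n) mod n"
          unfolding z a(2) by (simp add: mod_mult_right_eq mult_ac)
        ultimately show "u * b mod n \<in> G \<and> z \<in> multiples n l (u * b mod n)"
          using a(1) by (auto simp: multiples_def)
      qed
      show "finite {b \<in> G. z \<in> multiples n l b}" using fin by simp
    qed
  qed
  have xO: "x \<in> Orb" using assms by (simp add: Orb)
  \<comment> \<open>Double counting: the count is constant along the orbit, and each unit reaches
    exactly \<open>card T\<close> of its elements.\<close>
  have "card {b\<in>G. x \<in> multiples n l b} * card Orb = (\<Sum>y\<in>Orb. c x)" by (simp add: c_def)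
  also have "\<dots> = (\<Sum>y\<in>Orb. c y)" using const xO by (intro sum.cong) (auto intro: antisym)
  also have "\<dots> = (\<Sum>y\<in>Orb. \<Sum>b\<in>G. if y \<in> multiples n l b then 1 else 0)"
    unfolding c_def using fin by (simp add: sum.If_cases Int_def)
  also have "\<dots> = (\<Sum>b\<in>G. \<Sum>y\<in>Orb. if y \<in> multiples n l b then 1 else 0)" by (rule sum.swap)
  also have "\<dots> = (\<Sum>b\<in>G. card {y\<in>Orb. y \<in> multiples n l b})"
    using fin by (simp add: sum.If_cases Int_def)
  also have "\<dots> = (\<Sum>b\<in>G. card T)"
  proof (intro sum.cong refl)
    fix b assume b: "b \<in> G"
    have O: "a * b mod n \<in> Orb" if "a \<in> T" for a
    proof -
      have g: "gcd (a * b mod n) n = d" using gcd_unit_mult[of b n a] b that by (simp add: G_def T_def mult.commute)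
      have "0 < y" if "gcd y n = d" for y using dn that by (cases "y = 0") auto
      from this[OF g] show ?thesis unfolding Orb using g mod_less_divisor[OF n] by blast
    qed
    have "{y\<in>Orb. y \<in> multiples n l b} = (\<lambda>a. a * b mod n) ` T"
    proof (intro equalityI subsetI)
      fix y assume "y \<in> {y\<in>Orb. y \<in> multiples n l b}"
      then show "y \<in> (\<lambda>a. a * b mod n) ` T" using mu[OF b, of y] by blast
    next
      fix y assume "y \<in> (\<lambda>a. a * b mod n) ` T"
      then obtain a where "a \<in> T" "y = a * b mod n" by blast
      then show "y \<in> {y\<in>Orb. y \<in> multiples n l b}" using O mu[OF b, of y] by blast
    qed
    moreover have "inj_on (\<lambda>a. a * b mod n) T"
    proof (rule inj_onI)
      fix a a' assume a: "a \<in> T" "a' \<in> T" "a * b mod n = a' * b mod n"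
      then have "[a = a'] (mod n)" using cong_mult_rcancel_nat[of b n a a'] b by (simp add: Cong.cong_def G_def)
      then show "a = a'" using a assms(1) by (simp add: Cong.cong_def T_def)
    qed
    ultimately show "card {y\<in>Orb. y \<in> multiples n l b} = card T" by (simp add: card_image)
  qed
  finally show ?thesis by (simp add: G_def T_def cOrb)
qed

text \<open>Distinct multipliers \<open>a \<le> l\<close> may yield the same \<open>b\<close> with \<open>a * b = x\<close> only if the additive
  order \<open>n div gcd x n\<close> of \<open>x\<close> is at most \<open>l\<close>.\<close>

lemma card_covering_ge:
  assumes "Q \<subseteq> {a. a \<le> l \<and> coprime a n}" "l * gcd x n < n" "x < n"
  shows "card Q \<le> card {b\<in>{b. b < n \<and> gcd b n = gcd x n}. x \<in> multiples n l b}"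
proof -
  have n: "n > 0" using assms by simp
  \<comment> \<open>The witness is \<open>x\<close> times an inverse of \<open>a\<close>.\<close>
  have "\<exists>b. b < n \<and> gcd b n = gcd x n \<and> a * b mod n = x" if "a \<in> Q" for a
  proof -
    have a: "coprime a n" using that assms by auto
    obtain z where z: "[a * z = 1] (mod n)" using cong_solve_coprime_nat[OF a] by auto
    have cz: "coprime z n" using cong_imp_coprime[OF cong_sym[OF z]] by simp
    have "[a * (z * x mod n) = a * z * x] (mod n)" by (simp add: Cong.cong_def mod_mult_right_eq mult.assoc)
    also have "[a * z * x = 1 * x] (mod n)" using z by (rule cong_scalar_right)
    finally have "a * (z * x mod n) mod n = x" using assms(3) by (simp add: Cong.cong_def)
    moreover have "gcd (z * x mod n) n = gcd x n" using cz by (rule gcd_unit_mult)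
    ultimately show ?thesis using n by (intro exI[of _ "z * x mod n"]) auto
  qed
  then obtain f where f: "\<And>a. a \<in> Q \<Longrightarrow> f a < n \<and> gcd (f a) n = gcd x n \<and> a * f a mod n = x"
    by metis
  show ?thesis
  proof (rule card_inj_on_le[of f])
    show "inj_on f Q"
    proof (rule inj_onI)
      fix a a' assume a: "a \<in> Q" "a' \<in> Q" "f a = f a'"
      define b where "b = f a"
      define e where "e = gcd b n"
      have e: "e = gcd x n" "e > 0" using f a n by (auto simp: e_def b_def)
      \<comment> \<open>Cancelling \<open>b\<close> leaves a congruence modulo
        \<open>n div e\<close> only; since \<open>n div e > l\<close>, it still separates the
        multipliers.\<close>
      have "[a * b = a' * b] (mod n)" using f[OF a(1)] f[OF a(2)] a(3) by (simp add: Cong.cong_def b_def)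
      then have "[a * (b div e) * e = a' * (b div e) * e] (mod (n div e) * e)" 
        by (simp add: e_def mult.assoc)
      moreover have "[A = B] (mod M)" if "[A * e = B * e] (mod M * e)" for A B M
        using that e(2) by (simp add: Cong.cong_def flip: mult_mod_left)
      ultimately have "[a * (b div e) = a' * (b div e)] (mod (n div e))" by blast
      moreover have "coprime (b div e) (n div e)" unfolding e_def using n by (intro div_gcd_coprime) auto
      ultimately have "[a = a'] (mod (n div e))" by (simp add: cong_mult_rcancel_nat)
      moreover have "l < n div e" 
        using assms(2) e by (metis dvd_div_mult_self e_def gcd_dvd2 mult_less_cancel2)
      ultimately show "a = a'" using a(1,2) assms(1) cong_less_modulus_unique_nat[of a a' "n div e"] by fastforce
    qed
    show "f ` Q \<subseteq> {b\<in>{b. b < n \<and> gcd b n = gcd x n}. x \<in> multiples n l b}"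
      using f assms(1) by (fastforce simp: multiples_def)
  qed simp
qed

section \<open>Divisors and primes\<close>

text \<open>The least divisor \<open>e \<ge> t\<close> falls below \<open>t\<close> when one of its
  primes is removed, so it overshoots by a factor of at most \<open>T\<close>.\<close>

lemma exists_divisor_between:
  fixes t T :: real and n :: nat
  assumes "n > 0" "1 \<le> t" "1 \<le> T" "t \<le> real n" "\<And>p. prime p \<Longrightarrow> p dvd n \<Longrightarrow> real p \<le> T"
  shows "\<exists>e. e dvd n \<and> t \<le> real e \<and> real e \<le> t * T"
proof -
  define e where "e = (LEAST e. e dvd n \<and> t \<le> real e)"
  have e: "e dvd n \<and> t \<le> real e" unfolding e_def
    by (rule LeastI[where P = "\<lambda>e. e dvd n \<and> t \<le> real e" and k = n]) (use assms in auto)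
  have "real e \<le> t * T"
  proof (cases "e = 1")
    case True
    then show ?thesis using mult_mono[of 1 t 1 T] assms by simp
  next
    case False
    then obtain p where p: "prime p" "p dvd e" using prime_factor_nat by blast
    then obtain f where f: "e = p * f" by auto
    have "e > 0" using e assms by (auto intro: gr0I)
    then have "f < e" using f p prime_gt_1_nat[of p] by auto
    moreover have "f dvd n" using e f by (meson dvd_mult_right)
    ultimately have "real f < t" unfolding e_def using not_less_Least by fastforce
    moreover have "real p \<le> T" using assms(5) p e by (meson dvd_trans)
    ultimately show ?thesis unfolding f using assms by (simp add: mult_mono mult.commute[of t])
  qed
  then show ?thesis using e by blast
qed

text \<open>The \<open>r\<close> divisors are chosen so that their product divides \<open>n\<close>. Each prime factor of \<open>m\<close>
  spoils at most one of them.\<close>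

lemma exists_divisors_dividing_codivisors:
  fixes t T :: real and n :: nat
  assumes "n > 0" "1 \<le> t" "1 \<le> T" "(t * T) ^ r \<le> real n"
    "\<And>p. prime p \<Longrightarrow> p dvd n \<Longrightarrow> real p \<le> T"
  shows "\<exists>E. finite E \<and> card E \<le> r \<and> (\<forall>e\<in>E. e dvd n \<and> t \<le> real e) \<and>
    (\<forall>m. m dvd n \<longrightarrow> m < 2 ^ r \<longrightarrow> (\<exists>e\<in>E. e dvd n div m))"
  using assms(1,4,5)
proof (induction r arbitrary: n)
  case 0
  then show ?case by (intro exI[of _ "{}"]) auto
next
  case (Suc r)
  have tT: "1 \<le> t * T" using mult_mono[of 1 t 1 T] assms by simp
  have "t * 1 \<le> t * T" using assms by (intro mult_left_mono) auto
  also have "\<dots> * 1 \<le> t * T * (t * T) ^ r" using tT by (intro mult_left_mono) auto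
  also have "\<dots> \<le> real n" using Suc.prems(2) by simp
  finally have "t \<le> real n" by simp
  then obtain e where e: "e dvd n" "t \<le> real e" "real e \<le> t * T"
    using exists_divisor_between[of n t T] Suc.prems assms by auto
  then obtain n' where n': "n = e * n'" by auto
  have n'0: "n' > 0" "e > 0" using n' Suc.prems by (auto intro: gr0I)
  have "(t * T) * (t * T) ^ r \<le> real e * real n'" using Suc.prems(2) by (simp add: n')
  also have "\<dots> \<le> (t * T) * real n'" using e by (intro mult_right_mono) auto
  finally have "(t * T) ^ r \<le> real n'" using tT by (subst (asm) mult_le_cancel_left_pos) auto
  then obtain E where E: "finite E" "card E \<le> r" "\<And>e. e \<in> E \<Longrightarrow> e dvd n' \<and> t \<le> real e"
    "\<And>m. m dvd n' \<Longrightarrow> m < 2 ^ r \<Longrightarrow> \<exists>e\<in>E. e dvd n' div m"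
    using Suc.IH[of n'] Suc.prems(3) n'0 n' by auto
  have "\<exists>c\<in>insert e E. c dvd n div m" if m: "m dvd n" "m < 2 ^ Suc r" for m
  proof -
    \<comment> \<open>\<open>m2\<close> is the part of \<open>m\<close> that has to be taken from
      \<open>e\<close>. If it is 1, \<open>e\<close> itself divides \<open>n div m\<close>;
      otherwise \<open>m1 \<le> m / 2\<close> and the induction hypothesis supplies a divisor of
      \<open>k\<close>.\<close>
    define m1 where "m1 = gcd m n'"
    have m0: "m > 0" "m1 > 0" using m Suc.prems(1) n'0 by (auto simp: m1_def intro: gr0I)
    define m2 k where "m2 = m div m1" and "k = n' div m1"
    have mk: "m = m1 * m2" "n' = m1 * k"
      unfolding m1_def m2_def k_def by simp_all
    have "coprime m2 k" unfolding m2_def k_def m1_def using n'0 by (intro div_gcd_coprime) auto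
    have "m1 * m2 dvd m1 * (e * k)" using m(1) unfolding mk(1) n' mk(2) by (simp add: mult.left_commute)
    then have "m2 dvd e * k" using m0 by simp
    then have "m2 dvd e" using \<open>coprime m2 k\<close> by (simp add: coprime_dvd_mult_left_iff)
    then obtain j where j: "e = m2 * j" by auto
    have q: "n div m = j * k" using m0 unfolding n' j mk by (simp add: mult_ac)
    show ?thesis
    proof (cases "m2 = 1")
      case True
      then show ?thesis using q j by auto
    next
      case False
      then have "m2 \<ge> 2" using m0 mk(1) by (cases m2) auto
      then have "m1 * 2 \<le> m" unfolding mk(1) by (intro mult_left_mono) auto
      then have "m1 < 2 ^ r" using m(2) by simp
      then obtain c where "c \<in> E" "c dvd n' div m1" using E(4)[of m1] mk by auto
      then have "c dvd j * k" by (simp add: k_def)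
      then show ?thesis unfolding q using \<open>c \<in> E\<close> by blast
    qed
  qed
  moreover have "card (insert e E) \<le> Suc r" using E(1,2) by (simp add: card_insert_if)
  moreover have "\<And>c. c \<in> E \<Longrightarrow> c dvd n" using E(3) n' by (meson dvd_mult)
  ultimately show ?case using E e by (intro exI[of _ "insert e E"]) auto
qed

section \<open>Chebyshev's lower bound for primes not dividing \<open>n\<close>\<close>

text \<open>The entries of Leibniz' harmonic triangle satisfy
  \<open>1 / ((m + 2) * (m + 1 choose k + 1)) = 1 / ((m + 1) * (m choose k)) - 1 / ((m + 2) * (m + 1 choose k))\<close>.\<close>

lemma Suc_times_binomial_dvd_Lcm:
  assumes "k \<le> m" "m < N"
  shows "Suc m * (m choose k) dvd Lcm {1..N}"
  using assms
proof (induction k arbitrary: m)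
  case 0
  then show ?case by (auto intro: dvd_Lcm)
next
  case (Suc k)
  then obtain m' where m: "m = Suc m'" by (cases m) auto
  define L where "L = Lcm {1..N}"
  define c where "c = m' choose k"
  have d: "Suc m' * c dvd L" "Suc m * (m choose k) dvd L"
    unfolding L_def c_def using Suc.IH[of m'] Suc.IH[of m] Suc.prems m by (simp_all del: mult_Suc binomial_Suc_Suc)
  obtain A where A: "L = Suc m' * c * A" using d(1) by (rule dvdE)
  obtain B where B: "L = Suc m * (m choose k) * B" using d(2) by (rule dvdE)
  have i1: "Suc k * (m choose Suc k) = m * c"
    using Suc_times_binomial[of k m'] by (simp add: m c_def)
  have i2: "(m - k) * (m choose k) = m * c"
    using binomial_absorb_comp[of m k] by (simp add: m c_def)
  have k: "k \<le> m" using Suc by simp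
  define M C D where "M = int m" and "C = int (m choose k)" and "D = int (m choose Suc k)"
  have A': "int L = M * int c * int A" unfolding A M_def m by (simp only: of_nat_mult)
  have B': "int L = (M + 1) * C * int B" unfolding B M_def C_def by (simp only: of_nat_mult of_nat_Suc add.commute)
  have r1: "(int k + 1) * D = M * int c"
    using arg_cong[OF i1, of int] unfolding M_def D_def by (simp only: of_nat_mult of_nat_Suc add.commute)
  have r2: "(M - int k) * C = M * int c"
    using arg_cong[OF i2, of int] k unfolding M_def C_def by (simp only: of_nat_mult of_nat_diff)
  have "(int k + 1) * ((M + 1) * D * (int A - int B)) = (M + 1) * ((int k + 1) * D) * (int A - int B)"
    by (simp only: mult_ac)
  also have "\<dots> = (M + 1) * (M * int c * int A) - ((M - int k) * C) * ((M + 1) * int B)"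
    unfolding r1 r2 by (simp add: algebra_simps)
  also have "\<dots> = (M + 1) * (M * int c * int A) - (M - int k) * ((M + 1) * C * int B)"
    by (simp only: mult_ac)
  also have "\<dots> = (int k + 1) * int L"
    unfolding A'[symmetric] B'[symmetric] by (simp add: algebra_simps)
  finally have "(int k + 1) * ((M + 1) * D * (int A - int B)) = (int k + 1) * int L" .
  then have "int L = (M + 1) * D * (int A - int B)" by simp
  then have "int L = int (Suc m * (m choose Suc k)) * (int A - int B)"
    unfolding M_def D_def by (simp only: of_nat_mult of_nat_Suc add.commute)
  then have "int (Suc m * (m choose Suc k)) dvd int L" by simp
  then show ?case unfolding L_def by (simp only: int_dvd_int_iff)
qed

text \<open>The row sum \<open>2 ^ m\<close> is at most \<open>m + 1\<close> times the middle
  binomial coefficient, and this product divides the lcm.\<close>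

lemma Lcm_atLeastAtMost_ge: "2 ^ m \<le> Lcm {1..Suc m}"
proof -
  have "2 ^ m = (\<Sum>k\<le>m. m choose k)" by (simp add: choose_row_sum)
  also have "\<dots> \<le> (\<Sum>k\<le>m. m choose (m div 2))" by (intro sum_mono binomial_maximum)
  also have "\<dots> = Suc m * (m choose (m div 2))" by simp
  also have "\<dots> \<le> Lcm {1..Suc m}"
    by (rule dvd_imp_le[OF Suc_times_binomial_dvd_Lcm]) (auto intro: gr0I simp: Lcm_0_iff)
  finally show ?thesis .
qed

text \<open>The lcm divides the product of the largest prime powers not exceeding \<open>l\<close>,
  one factor for each prime.\<close>

lemma Lcm_atLeastAtMost_le:
  fixes l :: nat
  assumes "l > 0"
  shows "Lcm {1..l} \<le> l ^ card {p. prime p \<and> p \<le> l}"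
proof -
  define P where "P = {p. prime p \<and> p \<le> l}"
  define e where "e = (\<lambda>p. GREATEST k. p ^ k \<le> l)"
  have bound: "k \<le> l" if "prime p" "p ^ k \<le> l" for p k
    using that power_gt_expt[of p k] prime_gt_1_nat[of p] by simp
  have e: "p ^ e p \<le> l" if "prime p" for p
    unfolding e_def by (rule GreatestI_nat[where k = 0 and b = l]) (use assms bound that in auto)
  have e': "k \<le> e p" if "prime p" "p ^ k \<le> l" for p k
    unfolding e_def by (rule Greatest_le_nat[where b = l]) (use bound that in auto)
  have finP: "finite P" by (simp add: P_def)
  define M where "M = (\<Prod>p\<in>P. p ^ e p)"
  have M0: "M > 0" unfolding M_def P_def by (intro prod_pos) (auto simp: prime_gt_0_nat)
  have "x dvd M" if x: "x \<in> {1..l}" for x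
  proof (rule multiplicity_le_imp_dvd)
    show "x \<noteq> 0" using x by simp
    fix p :: nat assume p: "prime p"
    have "p ^ multiplicity p x dvd x" by (rule multiplicity_dvd)
    then have le: "p ^ multiplicity p x \<le> l" using x dvd_imp_le[of _ x] by fastforce
    show "multiplicity p x \<le> multiplicity p M"
    proof (cases "multiplicity p x = 0")
      case False
      then have "p ^ 1 \<le> p ^ multiplicity p x" using prime_ge_1_nat[OF p] by (intro power_increasing) auto
      then have "p \<in> P" using le p by (simp add: P_def)
      then have "p ^ e p dvd M" unfolding M_def using finP by (rule dvd_prodI[rotated])
      moreover have "p ^ multiplicity p x dvd p ^ e p" using e'[OF p le] by (rule le_imp_power_dvd)
      ultimately have "p ^ multiplicity p x dvd M" by (rule dvd_trans[rotated])
      then show ?thesis using M0 p by (intro multiplicity_geI) (auto simp: prime_gt_1_nat)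
    qed simp
  qed
  then have "Lcm {1..l} dvd M" by (rule Lcm_least)
  then have "Lcm {1..l} \<le> M" using M0 by (rule dvd_imp_le)
  also have "\<dots> \<le> (\<Prod>p\<in>P. l)" unfolding M_def by (intro prod_mono) (auto simp: P_def e)
  also have "\<dots> = l ^ card P" by simp
  finally show ?thesis by (simp add: P_def)
qed

lemma prod_primes_dvd:
  assumes "finite S" "\<And>p. p \<in> S \<Longrightarrow> prime p \<and> p dvd (n::nat)"
  shows "\<Prod>S dvd n"
  using assms
proof (induction S rule: finite_induct)
  case (insert p S)
  have "coprime p (\<Prod>S)"
    using insert by (intro prod_coprime_right primes_coprime) auto
  then show ?case using insert by (simp add: divides_mult)
qed simp

text \<open>The two lcm bounds give \<open>2 ^ (l - 1) \<le> l ^ card P\<close>. Of these primes at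
  most \<open>sqrt l\<close> are at most \<open>sqrt l\<close>, and the larger ones dividing
  \<open>n\<close> have a product of at most \<open>n\<close>, which bounds their number.\<close>

lemma card_primes_not_dvd_ge:
  fixes l n :: nat
  assumes "l \<ge> 2" "n > 0"
  shows "(real l - 1) * ln 2 / ln (real l) - sqrt (real l) - 2 * ln (real n) / ln (real l)
    \<le> real (card {p. prime p \<and> p \<le> l \<and> \<not> p dvd n})"
proof -
  define P where "P = {p. prime p \<and> p \<le> l}"
  define Q where "Q = {p. prime p \<and> p \<le> l \<and> \<not> p dvd n}"
  define S where "S = {p. prime p \<and> p \<le> l \<and> p dvd n \<and> sqrt (real l) < real p}"
  define R where "R = {p. 0 < p \<and> real p \<le> sqrt (real l)}"
  have lnl: "ln (real l) > 0" using assms by simp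
  have Rsub: "R \<subseteq> {1..nat \<lfloor>sqrt (real l)\<rfloor>}" by (auto simp: R_def le_nat_floor)
  have fin: "finite P" "finite Q" "finite S" "finite R"
    using finite_subset[OF Rsub] by (auto simp: P_def Q_def S_def)
  have "card R \<le> nat \<lfloor>sqrt (real l)\<rfloor>" using card_mono[OF _ Rsub] by simp
  then have cR: "real (card R) \<le> sqrt (real l)" by (simp add: le_nat_iff le_floor_iff)
  have "P \<subseteq> Q \<union> S \<union> R" by (auto simp: P_def Q_def S_def R_def prime_gt_0_nat)
  then have "card P \<le> card (Q \<union> S \<union> R)" using fin by (intro card_mono) auto
  also have "\<dots> \<le> card Q + card S + card R"
    by (meson add_le_mono1 card_Un_le le_trans)
  finally have cP: "real (card P) \<le> real (card Q) + real (card S) + real (card R)" by linarith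
  have "2 ^ (l - 1) \<le> l ^ card P"
    using Lcm_atLeastAtMost_ge[of "l - 1"] Lcm_atLeastAtMost_le[of l] assms by (simp add: P_def)
  then have "real (2 ^ (l - 1)) \<le> real (l ^ card P)" using of_nat_le_iff by blast
  then have "ln (2 ^ (l - 1)) \<le> ln (real l ^ card P)" using assms by simp
  then have 1: "(real l - 1) * ln 2 \<le> real (card P) * ln (real l)"
    using assms by (simp add: ln_realpow of_nat_diff)
  have "sqrt (real l) ^ card S \<le> (\<Prod>p\<in>S. real p)"
    using prod_mono[of S "\<lambda>_. sqrt (real l)" real] by (auto simp: S_def)
  also have "\<dots> = real (\<Prod>S)" by simp
  also have "\<Prod>S \<le> n" using assms fin(3) by (intro dvd_imp_le prod_primes_dvd) (auto simp: S_def)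
  finally have "sqrt (real l) ^ card S \<le> real n" by simp
  then have "ln (sqrt (real l) ^ card S) \<le> ln (real n)" using assms by (subst ln_le_cancel_iff) auto
  then have 2: "real (card S) * ln (real l) \<le> 2 * ln (real n)"
    using assms by (simp add: ln_realpow ln_sqrt)
  have "(real l - 1) * ln 2 / ln (real l) \<le> real (card P)" using 1 lnl by (simp add: field_simps)
  moreover have "real (card S) \<le> 2 * ln (real n) / ln (real l)" using 2 lnl by (simp add: field_simps)
  ultimately show ?thesis using cP cR unfolding Q_def by linarith
qed

lemma eventually_card_primes_not_dvd_ge:
  "\<exists>l0. \<forall>l\<ge>l0. \<forall>n>0. 8 * ln (real n) \<le> real l \<longrightarrow>
     real l / (8 * ln (real l)) \<le> real (card {p. prime p \<and> p \<le> l \<and> \<not> p dvd n})"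
proof -
  \<comment> \<open>Here \<open>ln 2\<close> is weakened to \<open>1/2\<close> and
    \<open>2 * ln n\<close> to \<open>l / 4\<close>. This leaves about
    \<open>l / (4 * ln l)\<close>, half of which absorbs the lower order terms.\<close>
  have "\<forall>\<^sub>F x::real in at_top. x / (8 * ln x) \<le> (x - 1) * (1/2) / ln x - sqrt x - (x/4) / ln x"
    by real_asymp
  then have "\<forall>\<^sub>F l::nat in at_top. real l / (8 * ln (real l)) \<le>
      (real l - 1) * (1/2) / ln (real l) - sqrt (real l) - (real l/4) / ln (real l)"
    using filterlim_real_sequentially by (rule eventually_compose_filterlim)
  then obtain l1 where l1: "\<And>l. l \<ge> l1 \<Longrightarrow> real l / (8 * ln (real l)) \<le>
      (real l - 1) * (1/2) / ln (real l) - sqrt (real l) - (real l/4) / ln (real l)"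
    unfolding eventually_at_top_linorder by blast
  have "real l / (8 * ln (real l)) \<le> real (card {p. prime p \<and> p \<le> l \<and> \<not> p dvd n})"
    if l: "l \<ge> max l1 2" and n: "n > 0" "8 * ln (real n) \<le> real l" for l n
  proof -
    have lnl: "ln (real l) > 0" using l by simp
    have "(1/2::real) \<le> ln 2" using ln_le_minus_one[of "1/2::real"] by (simp add: ln_div)
    then have "(real l - 1) * (1/2) / ln (real l) \<le> (real l - 1) * ln 2 / ln (real l)"
      using l lnl by (intro divide_right_mono mult_left_mono) auto
    moreover have "2 * ln (real n) / ln (real l) \<le> (real l/4) / ln (real l)"
      using n lnl by (intro divide_right_mono) auto
    ultimately show ?thesis using l1[of l] card_primes_not_dvd_ge[of l n] l n by linarith
  qed
  then show ?thesis by blast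
qed

section \<open>The covering sets\<close>

lemma card_prime_factors_le_ln:
  assumes "n > 0"
  shows "real (card (prime_factors n)) \<le> 2 * ln (real n)"
proof -
  have "(2::nat) ^ card (prime_factors n) = (\<Prod>p\<in>prime_factors n. 2)" by simp
  also have "\<dots> \<le> \<Prod>(prime_factors n)"
    by (intro prod_mono) (auto simp: prime_ge_2_nat in_prime_factors_iff)
  also have "\<dots> \<le> n" using assms
    by (intro dvd_imp_le prod_primes_dvd) (auto simp: in_prime_factors_iff)
  finally have "real (2 ^ card (prime_factors n)) \<le> real n" using of_nat_le_iff by blast
  then have "ln (2 ^ card (prime_factors n)) \<le> ln (real n)" using assms by simp
  then have "real (card (prime_factors n)) * ln 2 \<le> ln (real n)" by (simp add: ln_realpow)
  moreover have "real (card (prime_factors n)) * (1/2) \<le> real (card (prime_factors n)) * ln 2"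
    using ln_le_minus_one[of "1/2::real"] by (intro mult_left_mono) (auto simp: ln_div)
  ultimately show ?thesis by linarith
qed

text \<open>The logarithm of \<open>sieve_bound n\<close> is of order at most
  \<open>ln n powr (1/4)\<close>, so even its square is negligible against
  \<open>ln n\<close>.\<close>

lemma eventually_ln_sieve_bound_le:
  "\<exists>n0. \<forall>n\<ge>n0. 100 * (ln (sieve_bound n ^ 4))\<^sup>2 \<le> ln (real n)"
proof -
  define h :: "real \<Rightarrow> real" where "h = (\<lambda>u. 4 * (ln (2 * (2 * u + 1)) + 10 * (2 * u) powr (1/4)))"
  have "\<forall>\<^sub>F x::real in at_top. 100 * (h (ln x))\<^sup>2 \<le> ln x" unfolding h_def by real_asymp
  then have "\<forall>\<^sub>F n::nat in at_top. 100 * (h (ln (real n)))\<^sup>2 \<le> ln (real n)"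
    using filterlim_real_sequentially by (rule eventually_compose_filterlim)
  then obtain n1 where n1: "\<And>n. n \<ge> n1 \<Longrightarrow> 100 * (h (ln (real n)))\<^sup>2 \<le> ln (real n)"
    unfolding eventually_at_top_linorder by blast
  have "100 * (ln (sieve_bound n ^ 4))\<^sup>2 \<le> ln (real n)" if n: "n \<ge> max n1 1" for n
  proof -
    define w where "w = real (card (prime_factors n))"
    have w: "0 \<le> w" "w \<le> 2 * ln (real n)" using card_prime_factors_le_ln[of n] n by (auto simp: w_def)
    have "ln (sieve_bound n ^ 4) = 4 * ln (sieve_bound n)" using sieve_bound_ge_2[of n] by (simp add: ln_realpow)
    also have "ln (sieve_bound n) = ln (2 * (w + 1)) + 10 * w powr (1/4)"
      using w by (simp add: sieve_bound_def w_def Let_def ln_mult)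
    also have "4 * \<dots> \<le> h (ln (real n))"
    proof -
      have "ln (2 * (w + 1)) \<le> ln (2 * (2 * ln (real n) + 1))" using w by (subst ln_le_cancel_iff) auto
      moreover have "w powr (1/4) \<le> (2 * ln (real n)) powr (1/4)" using w by (intro powr_mono2) auto
      ultimately show ?thesis by (simp add: h_def)
    qed
    finally have "ln (sieve_bound n ^ 4) \<le> h (ln (real n))" .
    moreover have "0 \<le> ln (sieve_bound n ^ 4)" using sieve_bound_ge_2[of n] by (simp add: one_le_power)
    ultimately have "(ln (sieve_bound n ^ 4))\<^sup>2 \<le> (h (ln (real n)))\<^sup>2" by (intro power_mono)
    then show ?thesis using n1[of n] n by simp
  qed
  then show ?thesis by blast
qed

lemma covers_divisors:
  assumes "\<And>e. e \<in> E \<Longrightarrow> n \<le> l * e" "\<And>x. x \<in> U \<Longrightarrow> 0 < x \<and> x < n \<and> (\<exists>e\<in>E. e dvd x)"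
  shows "covers n l (E \<inter> {..<n}) U"
proof -
  have "\<exists>e\<in>E \<inter> {..<n}. x \<in> multiples n l e" if x: "x \<in> U" for x
  proof -
    obtain e where e: "0 < x" "x < n" "e \<in> E" "e dvd x" using assms(2)[OF x] by auto
    then have "e < n" using dvd_imp_le[of e x] by linarith
    then show ?thesis using dvd_in_multiples[of e x n l] e assms(1) by auto
  qed
  then show ?thesis by (auto simp: covers_def)
qed

text \<open>The greedy candidates are the \<open>b\<close> with large gcd. Inverting the multipliers
  in \<open>Q\<close> yields \<open>card Q\<close> elements covering \<open>x\<close>, all with the
  gcd of \<open>x\<close> and hence among the candidates.\<close>

lemma cover_by_multipliers:
  fixes D :: real
  assumes "1 \<le> l" "l < n" "Q \<subseteq> {a. a \<le> l \<and> coprime a n}" "Q \<noteq> {}"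
  shows "\<exists>B. covers n l B {x. x < n \<and> D < real (gcd x n) \<and> l * gcd x n < n} \<and>
    real (card B) \<le> real (card {b. b < n \<and> D < real (gcd b n)}) / real (card Q) * ln (real l) + 2 * real n / real l"
proof (rule greedy_cover)
  have "finite Q" by (rule finite_subset[of _ "{..l}"]) (use assms(3) in auto)
  then show "0 < real (card Q)" using assms(4) by (simp add: card_gt_0_iff)
  fix x assume x: "x \<in> {x. x < n \<and> D < real (gcd x n) \<and> l * gcd x n < n}"
  have "card Q \<le> card {b\<in>{b. b < n \<and> gcd b n = gcd x n}. x \<in> multiples n l b}"
    using x by (intro card_covering_ge assms) auto
  also have "\<dots> \<le> card {b\<in>{b. b < n \<and> D < real (gcd b n)}. x \<in> multiples n l b}"
    using x by (intro card_mono) auto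
  finally show "real (card Q) \<le> real (card {b\<in>{b. b < n \<and> D < real (gcd b n)}. x \<in> multiples n l b})"
    by simp
qed (use assms in auto)

lemma card_multiples_less:
  assumes "d dvd n" "n > 0"
  shows "card {b::nat. b < n \<and> d dvd b} = n div d"
proof -
  obtain k where k: "n = d * k" using assms by auto
  have d: "d > 0" using assms by (auto intro: gr0I)
  have "{b. b < n \<and> d dvd b} = (*) d ` {..<k}" using d by (auto simp: k)
  then show ?thesis using d by (simp add: card_image inj_on_def k)
qed

lemma exp_eq_sieve_bound:
  "exp (10 * real (card (prime_factors n)) powr (1/4)) = sieve_bound n / (2 * (real (card (prime_factors n)) + 1))"
  by (simp add: sieve_bound_def Let_def)

text \<open>Each divisor \<open>d > D\<close> accounts for \<open>n / d\<close> elements, and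
  \<open>1 / d \<le> d powr (-3/4) / H\<close>. The factor \<open>H\<close> cancels against the
  bound for the divisor sum and only \<open>1 / (2 * (w + 1))\<close> is left.\<close>

lemma card_large_gcd_le:
  assumes "n > 0" "D \<ge> sieve_bound n ^ 4"
  shows "real (card {b. b < n \<and> D < real (gcd b n)}) \<le> real n / (2 * (real (card (prime_factors n)) + 1))"
proof -
  define H where "H = sieve_bound n"
  have H: "H \<ge> 2" using sieve_bound_ge_2 by (simp add: H_def)
  define W where "W = {d. d dvd n \<and> D < real d}"
  have fin: "finite W" unfolding W_def by (rule finite_subset[OF _ finite_divisors_nat[OF assms(1)]]) auto
  have "{b. b < n \<and> D < real (gcd b n)} \<subseteq> (\<Union>d\<in>W. {b. b < n \<and> d dvd b})"
    by (auto simp: W_def intro!: bexI[of _ "gcd _ n"])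
  then have "card {b. b < n \<and> D < real (gcd b n)} \<le> card (\<Union>d\<in>W. {b. b < n \<and> d dvd b})"
    using fin by (intro card_mono) auto
  also have "\<dots> \<le> (\<Sum>d\<in>W. card {b. b < n \<and> d dvd b})" using fin by (rule card_UN_le)
  also have "\<dots> = (\<Sum>d\<in>W. n div d)" using assms by (intro sum.cong card_multiples_less) (auto simp: W_def)
  finally have "real (card {b. b < n \<and> D < real (gcd b n)}) \<le> real (\<Sum>d\<in>W. n div d)" by (simp only: of_nat_le_iff)
  also have "\<dots> = (\<Sum>d\<in>W. real n / real d)" by (simp add: W_def real_of_nat_div)
  also have "\<dots> \<le> (\<Sum>d\<in>W. real n / H * real d powr (-3/4))"
  proof (rule sum_mono)
    fix d assume d: "d \<in> W"
    have d0: "real d > 0" using d assms by (auto simp: W_def intro: gr0I)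
    have "H = (H ^ 4) powr (1/4)" using H by (simp add: power4_powr_quarter)
    also have "\<dots> \<le> real d powr (1/4)" using d assms(2) H by (intro powr_mono2) (auto simp: W_def H_def)
    finally have Hd: "H \<le> real d powr (1/4)" .
    have "1 / real d = real d powr (-3/4 - 1/4)" using d0 by (simp add: powr_minus_divide)
    also have "\<dots> = real d powr (-3/4) / real d powr (1/4)" by (rule powr_diff)
    also have "\<dots> \<le> real d powr (-3/4) / H" using Hd H d0 by (intro divide_left_mono) auto
    finally have "real n * (1 / real d) \<le> real n * (real d powr (-3/4) / H)" by (intro mult_left_mono) auto
    then show "real n / real d \<le> real n / H * real d powr (-3/4)" by simp
  qed
  also have "\<dots> = real n / H * (\<Sum>d\<in>W. real d powr (-3/4))" by (simp add: sum_distrib_left)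
  also have "\<dots> \<le> real n / H * (H / (2 * (real (card (prime_factors n)) + 1)))"
  proof (rule mult_left_mono)
    have "(\<Sum>d\<in>W. real d powr (-3/4)) \<le> (\<Sum>d | d dvd n. real d powr (-3/4))"
      using assms by (intro sum_mono2) (auto simp: W_def)
    then show "(\<Sum>d\<in>W. real d powr (-3/4)) \<le> H / (2 * (real (card (prime_factors n)) + 1))"
      using sum_divisors_powr_le[OF assms(1)] by (simp add: exp_eq_sieve_bound H_def)
  qed (use H in auto)
  also have "\<dots> = real n / (2 * (real (card (prime_factors n)) + 1))" using H by simp
  finally show ?thesis .
qed

text \<open>Rankin's trick: each \<open>m < X\<close> is counted with weight
  \<open>(X / m) powr (3/4) \<ge> 1\<close>.\<close>

lemma card_small_divisors_le:
  assumes "n > 0" "X > 0"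
  shows "real (card {m. m dvd n \<and> real m < X}) \<le> X powr (3/4) * sieve_bound n"
proof -
  define V where "V = {m. m dvd n \<and> real m < X}"
  have V: "V \<subseteq> {m. m dvd n}" by (auto simp: V_def)
  have "real (card V) = (\<Sum>m\<in>V. 1)" by simp
  also have "\<dots> \<le> (\<Sum>m\<in>V. X powr (3/4) * real m powr (-3/4))"
  proof (rule sum_mono)
    fix m assume m: "m \<in> V"
    have m0: "real m > 0" using m assms by (auto simp: V_def intro: gr0I)
    have "real m powr (3/4) \<le> X powr (3/4)" using m by (intro powr_mono2) (auto simp: V_def)
    then show "1 \<le> X powr (3/4) * real m powr (-3/4)" using m0 by (simp add: powr_minus_divide field_simps)
  qed
  also have "\<dots> = X powr (3/4) * (\<Sum>m\<in>V. real m powr (-3/4))" by (simp add: sum_distrib_left)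
  also have "\<dots> \<le> X powr (3/4) * sieve_bound n"
  proof (rule mult_left_mono)
    have "(\<Sum>m\<in>V. real m powr (-3/4)) \<le> (\<Sum>m | m dvd n. real m powr (-3/4))"
      using assms V by (intro sum_mono2) auto
    also have "\<dots> \<le> exp (10 * real (card (prime_factors n)) powr (1/4))" by (rule sum_divisors_powr_le[OF assms(1)])
    also have "\<dots> \<le> sieve_bound n" unfolding exp_eq_sieve_bound
      using sieve_bound_ge_2[of n] by (simp add: field_simps)
    finally show "(\<Sum>m\<in>V. real m powr (-3/4)) \<le> sieve_bound n" .
  qed simp
  finally show ?thesis by (simp add: V_def)
qed

section \<open>Covers for the separate ranges of \<open>l\<close> and of the gcd\<close>

text \<open>Multipliers with gcd \<open>d\<close> include \<open>d * a\<close> with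
  \<open>a \<le> l / d\<close> coprime to \<open>m = n / d\<close>. The sieve finds at least
  \<open>l * totient m / (2 * n)\<close> of them, and \<open>totient m\<close> cancels against the
  orbit size, so every such \<open>x\<close> is covered by a proportion \<open>l / (2 * n)\<close>
  of the units.\<close>

lemma cover_by_units:
  assumes "1 \<le> l" "l < n"
  shows "\<exists>B. covers n l B {x. 0 < x \<and> x < n \<and> real (gcd x n) * sieve_bound n ^ 4 \<le> real l} \<and>
    real (card B) \<le> 2 * real n / real l * ln (real l) + 2 * real n / real l"
proof -
  define G where "G = {b. b < n \<and> coprime b n}"
  have n: "n > 0" using assms by simp
  have "1 mod n \<in> G" using n by (auto simp: G_def)
  then have G: "card G > 0" by (auto simp: card_gt_0_iff G_def)
  define N where "N = real (card G) * real l / (2 * real n)"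
  have "\<exists>B. covers n l B {x. 0 < x \<and> x < n \<and> real (gcd x n) * sieve_bound n ^ 4 \<le> real l} \<and>
    real (card B) \<le> real (card G) / N * ln (real l) + 2 * real n / real l"
  proof (rule greedy_cover)
    show "N > 0" using G assms by (simp add: N_def)
    fix x assume x: "x \<in> {x. 0 < x \<and> x < n \<and> real (gcd x n) * sieve_bound n ^ 4 \<le> real l}"
    define d where "d = gcd x n"
    define m where "m = n div d"
    have d: "d > 0" "d dvd n" using n by (auto simp: d_def)
    have nm: "n = d * m" using d by (simp add: m_def)
    then have m: "m > 0" "m dvd n" using n by (auto intro: gr0I)
    define T where "T = {a. a \<le> l \<and> 0 < a \<and> gcd a n = d}"
    define S where "S = {a. 0 < a \<and> real a \<le> real l / real d \<and> coprime a m}"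
    have "(*) d ` S \<subseteq> T"
    proof clarify
      fix a assume a: "a \<in> S"
      then have "real (d * a) \<le> real l" using d by (simp add: S_def field_simps)
      then have "d * a \<le> l" by (simp only: of_nat_le_iff)
      moreover have "gcd (d * a) n = d" using a unfolding nm by (simp add: gcd_mult_distrib_nat[symmetric] S_def)
      ultimately show "d * a \<in> T" using a d by (simp add: T_def S_def)
    qed
    moreover have "inj_on ((*) d) S" using d by (auto simp: inj_on_def)
    ultimately have "card S \<le> card T" using card_inj_on_le[of "(*) d" S T] by (simp add: T_def)
    moreover have "real (card S) \<ge> real l / real d * (real (totient m) / real m) / 2"
      unfolding S_def using x d by (intro card_coprime_ge[OF m(2) n]) (auto simp: field_simps d_def)
    ultimately have T: "real (card T) \<ge> real l * real (totient m) / (2 * real n)"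
      unfolding nm by (simp add: field_simps)
    define c where "c = card {b\<in>G. x \<in> multiples n l b}"
    have "c * totient m = card G * card T"
      unfolding c_def G_def T_def m_def d_def using x assms by (intro card_units_covering) auto
    then have "real c * real (totient m) = real (card G) * real (card T)"
      by (simp flip: of_nat_mult)
    also have "\<dots> \<ge> real (card G) * (real l * real (totient m) / (2 * real n))"
      using T by (intro mult_left_mono) auto
    also have "real (card G) * (real l * real (totient m) / (2 * real n)) = N * real (totient m)"
      by (simp add: N_def)
    finally have "N * real (totient m) \<le> real c * real (totient m)" .
    then show "N \<le> real (card {b\<in>G. x \<in> multiples n l b})"
      using m by (simp add: c_def)
  qed (use assms in \<open>auto simp: G_def\<close>)
  moreover have "real (card G) / N = 2 * real n / real l" using G assms by (simp add: N_def)
  ultimately show ?thesis by simp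
qed

lemma inj_on_codivisor:
  assumes "n > 0"
  shows "inj_on (\<lambda>e. n div e) {e. e dvd (n::nat)}"
proof (rule inj_onI)
  fix a b assume ab: "a \<in> {e. e dvd n}" "b \<in> {e. e dvd n}" "n div a = n div b"
  have *: "n div (n div e) = e" if "e \<in> {e. e dvd n}" for e using assms that by (simp add: div_div_eq_right)
  show "a = b" using *[OF ab(1)] *[OF ab(2)] unfolding ab(3) by (rule trans[OF sym])
qed

lemma target_size_ge:
  assumes "l < n" "1 \<le> l"
  defines "X \<equiv> real n * logc (real n) / real l"
  shows "real n / real l \<le> X" "real n / real l * ln (real l) \<le> X" "ln (real n) \<le> X" "1 \<le> X"
    "real n / real l * ln (real n) \<le> X"
proof -
  have lc: "1 \<le> logc (real n)" "ln (real n) \<le> logc (real n)" "ln (real l) \<le> logc (real n)"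
    using assms by (auto simp: logc_def le_max_iff_disj)
  have nl: "1 \<le> real n / real l" using assms by simp
  have "real n / real l * 1 \<le> real n / real l * logc (real n)" using lc by (intro mult_left_mono) auto
  then show 1: "real n / real l \<le> X" by (simp add: X_def)
  have "real n / real l * ln (real l) \<le> real n / real l * logc (real n)" using lc by (intro mult_left_mono) auto
  then show "real n / real l * ln (real l) \<le> X" by (simp add: X_def)
  have "real n / real l * ln (real n) \<le> real n / real l * logc (real n)" using lc by (intro mult_left_mono) auto
  then show "real n / real l * ln (real n) \<le> X" by (simp add: X_def)
  have "1 * ln (real n) \<le> real n / real l * logc (real n)" using lc nl assms by (intro mult_mono) auto
  then show "ln (real n) \<le> X" by (simp add: X_def)
  show "1 \<le> X" using 1 nl by linarith
qed

lemma cover_small_l: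
  assumes "2 \<le> l" "l * l \<le> n" "(ln (real l))\<^sup>2 \<le> ln (real n)"
    "real l / (8 * ln (real l)) \<le> real (card {p. prime p \<and> p \<le> l \<and> \<not> p dvd n})"
  shows "\<exists>B. covers n l B {x. 0 < x \<and> x < n} \<and> real (card B) \<le> 11 * (real n * logc (real n) / real l)"
proof -
  define Q where "Q = {p. prime p \<and> p \<le> l \<and> \<not> p dvd n}"
  define X where "X = real n * logc (real n) / real l"
  have ll: "1 \<le> l" "l < n" using assms(1,2) mult_le_mono1[of 2 l l] by linarith+
  then have n: "n > 0" by simp
  note X = target_size_ge[OF ll(2,1), folded X_def]
  have lnl: "ln (real l) > 0" using assms by simp
  have q: "real l / (8 * ln (real l)) > 0" using assms lnl by simp
  then have Q0: "real (card Q) > 0" using assms(4) unfolding Q_def by linarith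
  then have "Q \<noteq> {}" by auto
  moreover have "Q \<subseteq> {a. a \<le> l \<and> coprime a n}" by (auto simp: Q_def intro: prime_imp_coprime)
  \<comment> \<open>The bound \<open>-1\<close> imposes no condition on the gcd.\<close>
  ultimately obtain B where B: "covers n l B {x. x < n \<and> -1 < real (gcd x n) \<and> l * gcd x n < n}"
    "real (card B) \<le> real (card {b. b < n \<and> -1 < real (gcd b n)}) / real (card Q) * ln (real l) + 2 * real n / real l"
    using cover_by_multipliers[OF ll, of Q "-1"] by blast
  define E where "E = {e. e dvd n \<and> n \<le> l * e}"
  have fE: "finite E" unfolding E_def using n by simp
  have cE: "covers n l (E \<inter> {..<n}) {x. 0 < x \<and> x < n \<and> n \<le> l * gcd x n}"
    by (rule covers_divisors) (auto simp: E_def intro!: bexI[of _ "gcd _ n"])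
  \<comment> \<open>The codivisors \<open>n / e\<close> are at most \<open>l\<close>, and
    \<open>l \<le> n / l\<close> makes this affordable.\<close>
  have "card E \<le> card {1..l}"
  proof (rule card_inj_on_le)
    show "inj_on (\<lambda>e. n div e) E" using inj_on_codivisor[OF n] by (rule inj_on_subset) (auto simp: E_def)
    show "(\<lambda>e. n div e) ` E \<subseteq> {1..l}"
    proof (rule image_subsetI)
      fix e assume e: "e \<in> E"
      then have "e > 0" using n by (auto simp: E_def intro: gr0I)
      moreover have "n div e \<le> l * e div e" using e by (intro div_le_mono) (auto simp: E_def)
      moreover have "n div e > 0" using e n \<open>e > 0\<close> by (simp add: E_def div_greater_zero_iff dvd_imp_le)
      ultimately show "n div e \<in> {1..l}" by simp
    qed
  qed simp
  then have "card (E \<inter> {..<n}) \<le> l" using card_mono[of E "E \<inter> {..<n}"] fE by simp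
  moreover have "real l \<le> real n / real l"
    using assms(1,2) by (simp add: le_divide_eq flip: of_nat_mult)
  ultimately have E: "real (card (E \<inter> {..<n})) \<le> X" using X(1) by linarith
  have "real (card {b. b < n \<and> -1 < real (gcd b n)}) \<le> real n"
    using card_mono[of "{..<n}" "{b. b < n \<and> -1 < real (gcd b n)}"] by auto
  then have "real (card {b. b < n \<and> -1 < real (gcd b n)}) / real (card Q) \<le> real n / (real l / (8 * ln (real l)))"
    using assms(4) q by (intro frac_le) (auto simp: Q_def)
  then have "real (card {b. b < n \<and> -1 < real (gcd b n)}) / real (card Q) * ln (real l)
      \<le> real n / (real l / (8 * ln (real l))) * ln (real l)"
    using lnl by (intro mult_right_mono) auto
  also have "\<dots> = 8 * (real n / real l * (ln (real l))\<^sup>2)" by (simp add: power2_eq_square)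
  also have "\<dots> \<le> 8 * (real n / real l * ln (real n))" using assms(3) by (intro mult_left_mono) auto
  also have "\<dots> \<le> 8 * X" using X(5) by simp
  finally have "real (card B) \<le> 8 * X + 2 * X" using B(2) X(1) by linarith
  then have "real (card (B \<union> (E \<inter> {..<n}))) \<le> 11 * X" using E card_Un_le[of B "E \<inter> {..<n}"] by linarith
  moreover have "covers n l (B \<union> (E \<inter> {..<n})) {x. 0 < x \<and> x < n}"
    by (rule covers_mono[OF covers_Un[OF B(1) cE]]) auto
  ultimately show ?thesis unfolding X_def by blast
qed

text \<open>With \<open>D = l / Y \<ge> Y\<close> there are few candidates of gcd above
  \<open>D\<close>; the saving \<open>2 * (w + 1)\<close> compensates the loss in the number of
  multipliers coprime to \<open>n\<close>. The \<open>x\<close> of additive order at most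
  \<open>l\<close> are covered by their gcds.\<close>

lemma cover_large_gcd_large_quotient:
  assumes "1 \<le> l" "l < n" "(sieve_bound n ^ 4)\<^sup>2 \<le> real l" "(sieve_bound n ^ 4) ^ 4 \<le> real n / real l"
  shows "\<exists>B. covers n l B {x. 0 < x \<and> x < n \<and> real l < real (gcd x n) * sieve_bound n ^ 4} \<and>
    real (card B) \<le> 4 * (real n * logc (real n) / real l)"
proof -
  define X where "X = real n * logc (real n) / real l"
  note X = target_size_ge[OF assms(2,1), folded X_def]
  define Y where "Y = sieve_bound n ^ 4"
  define w where "w = real (card (prime_factors n))"
  have n: "n > 0" using assms by simp
  have H: "sieve_bound n \<ge> 2" by (rule sieve_bound_ge_2)
  have Y: "Y \<ge> 1" using H by (simp add: Y_def one_le_power)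
  define D where "D = real l / Y"
  have DY: "Y \<le> D" using assms(3) Y by (simp add: D_def Y_def[symmetric] power2_eq_square field_simps)
  define Q where "Q = {a. 0 < a \<and> real a \<le> real l \<and> coprime a n}"
  have "Y * 1 \<le> Y * Y" using Y by (intro mult_left_mono) auto
  then have Yl: "Y \<le> real l" using assms(3) by (simp add: Y_def[symmetric] power2_eq_square)
  have "real l / (2 * (w + 1)) = real l * (1 / (w + 1)) / 2" by simp
  also have "\<dots> \<le> real l * (real (totient n) / real n) / 2"
    using totient_ratio_ge[OF n] by (intro divide_right_mono mult_left_mono) (auto simp: w_def)
  also have "\<dots> \<le> real (card Q)"
    unfolding Q_def using Yl n by (intro card_coprime_ge[of n n]) (auto simp: Y_def)
  finally have cQ: "real l / (2 * (w + 1)) \<le> real (card Q)" .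
  have q: "real l / (2 * (w + 1)) > 0" using assms by (simp add: w_def)
  then have "Q \<noteq> {}" using cQ by auto
  moreover have "Q \<subseteq> {a. a \<le> l \<and> coprime a n}" by (auto simp: Q_def)
  ultimately obtain B where B: "covers n l B {x. x < n \<and> D < real (gcd x n) \<and> l * gcd x n < n}"
    "real (card B) \<le> real (card {b. b < n \<and> D < real (gcd b n)}) / real (card Q) * ln (real l) + 2 * real n / real l"
    using cover_by_multipliers[OF assms(1,2), of Q D] by blast
  have "real (card {b. b < n \<and> D < real (gcd b n)}) / real (card Q) 
      \<le> (real n / (2 * (w + 1))) / (real l / (2 * (w + 1)))"
    using card_large_gcd_le[OF n, of D] DY cQ q by (intro frac_le) (auto simp: Y_def w_def)
  also have "\<dots> = real n / real l" by (simp add: w_def divide_simps)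
  finally have "real (card {b. b < n \<and> D < real (gcd b n)}) / real (card Q) * ln (real l)
      \<le> real n / real l * ln (real l)" using assms by (intro mult_right_mono) auto
  then have cB: "real (card B) \<le> 3 * X" using B(2) X(1,2) by linarith
  define E where "E = {e. e dvd n \<and> n \<le> l * e \<and> D < real e}"
  have fE: "finite E" unfolding E_def using n by simp
  have cE: "covers n l (E \<inter> {..<n}) {x. 0 < x \<and> x < n \<and> D < real (gcd x n) \<and> n \<le> l * gcd x n}"
    by (rule covers_divisors) (auto simp: E_def intro!: bexI[of _ "gcd _ n"])
  define t where "t = real n / real l"
  have t: "t > 0" using assms by (simp add: t_def)
  \<comment> \<open>Codivisors of \<open>E\<close> are below \<open>t * Y\<close>. There are at most
    \<open>(t * Y) powr (3/4) * sieve_bound n = t powr (3/4) * Y\<close> such divisors, and this is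
    at most \<open>t\<close> because \<open>Y ^ 4 \<le> t\<close>.\<close>
  have "card E \<le> card {m. m dvd n \<and> real m < t * Y}"
  proof (rule card_inj_on_le)
    show "inj_on (\<lambda>e. n div e) E" using inj_on_codivisor[OF n] by (rule inj_on_subset) (auto simp: E_def)
    show "(\<lambda>e. n div e) ` E \<subseteq> {m. m dvd n \<and> real m < t * Y}"
    proof (rule image_subsetI)
      fix e assume e: "e \<in> E"
      then have e0: "real e > 0" using n by (auto simp: E_def intro: gr0I)
      have "real (n div e) = real n / real e" using e by (simp add: E_def real_of_nat_div)
      also have "\<dots> < real n / D" using e n Y assms DY by (intro divide_strict_left_mono) (auto simp: E_def D_def)
      also have "\<dots> = t * Y" by (simp add: D_def t_def)
      finally show "n div e \<in> {m. m dvd n \<and> real m < t * Y}" using e by (auto simp: E_def)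
    qed
    show "finite {m. m dvd n \<and> real m < t * Y}" using n by simp
  qed
  also have "real \<dots> \<le> (t * Y) powr (3/4) * sieve_bound n"
    using n t Y by (intro card_small_divisors_le) auto
  also have "\<dots> = t powr (3/4) * (Y powr (3/4) * Y powr (1/4))"
    using H by (simp add: powr_mult Y_def power4_powr_quarter)
  also have "Y powr (3/4) * Y powr (1/4) = Y" using Y by (simp flip: powr_add)
  also have "t powr (3/4) * Y \<le> t powr (3/4) * t powr (1/4)"
  proof (rule mult_left_mono)
    have "Y = (Y ^ 4) powr (1/4)" using Y by (simp add: power4_powr_quarter)
    also have "\<dots> \<le> t powr (1/4)" using assms(4) by (intro powr_mono2) (auto simp: t_def Y_def)
    finally show "Y \<le> t powr (1/4)" .
  qed simp
  also have "\<dots> = t" using t by (simp flip: powr_add)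
  finally have "real (card E) \<le> X" using X(1) by (simp add: t_def)
  moreover have "card (E \<inter> {..<n}) \<le> card E" using fE by (intro card_mono) auto
  ultimately have "real (card (B \<union> (E \<inter> {..<n}))) \<le> 4 * X"
    using cB card_Un_le[of B "E \<inter> {..<n}"] by linarith
  moreover have "covers n l (B \<union> (E \<inter> {..<n})) {x. 0 < x \<and> x < n \<and> real l < real (gcd x n) * Y}"
    by (rule covers_mono[OF covers_Un[OF B(1) cE]]) (use Y in \<open>auto simp: D_def field_simps\<close>)
  ultimately show ?thesis unfolding X_def Y_def by blast
qed

text \<open>Here \<open>n div gcd x n\<close> is small, so that a few divisors of \<open>n\<close> exceeding \<open>n / l\<close> suffice to have
  one of them divide every such \<open>gcd x n\<close>, and a divisor \<open>e \<ge> n / l\<close> covers all multiples of \<open>e\<close>.\<close>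

lemma cover_large_gcd_small_quotient:
  assumes "1 \<le> l" "l < n" "real n / real l < (sieve_bound n ^ 4) ^ 4"
    "100 * (ln (sieve_bound n ^ 4))\<^sup>2 \<le> ln (real n)"
  shows "\<exists>B. covers n l B {x. 0 < x \<and> x < n \<and> real l < real (gcd x n) * sieve_bound n ^ 4} \<and>
    real (card B) \<le> real n * logc (real n) / real l"
proof -
  define X where "X = real n * logc (real n) / real l"
  note X = target_size_ge[OF assms(2,1), folded X_def]
  define Y where "Y = sieve_bound n ^ 4"
  have n: "n > 0" using assms by simp
  have "2 ^ 4 \<le> Y" unfolding Y_def by (intro power_mono sieve_bound_ge_2) auto
  then have Y: "Y \<ge> 16" by simp
  have "exp 1 \<le> Y" using Y exp_le by linarith
  then have lnY: "ln Y \<ge> 1" using Y by (subst ln_ge_iff) auto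
  have big: "n \<le> l * e" if "Y ^ 4 \<le> real e" for e
  proof -
    have "real n / real l \<le> real e" using that assms(3) by (simp add: Y_def)
    then have "real n \<le> real (l * e)" using assms(1) by (simp add: field_simps)
    then show ?thesis by (simp only: of_nat_le_iff)
  qed
  \<comment> \<open>The gcd exceeds \<open>l / Y\<close> and \<open>n / l\<close> is below
    \<open>Y ^ 4\<close>.\<close>
  have m_less: "real (n div gcd x n) < Y ^ 5" if "real l < real (gcd x n) * Y" for x
  proof -
    have g: "real (gcd x n) > 0" using n by simp
    have "real (n div gcd x n) = real n / real (gcd x n)" by (simp add: real_of_nat_div)
    also have "\<dots> < real n / (real l / Y)" using that g Y assms n by (intro divide_strict_left_mono) (auto simp: field_simps)
    also have "\<dots> = real n / real l * Y" by simp
    also have "\<dots> \<le> Y ^ 4 * Y" using assms(3) Y by (intro mult_right_mono) (auto simp: Y_def)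
    finally show ?thesis by (simp add: power_Suc[of _ 4, simplified] mult.commute)
  qed
  define U where "U = {x. 0 < x \<and> x < n \<and> real l < real (gcd x n) * Y}"
  have "\<exists>E. finite E \<and> real (card E) \<le> X \<and> (\<forall>e\<in>E. Y ^ 4 \<le> real e) \<and> (\<forall>x\<in>U. \<exists>e\<in>E. e dvd x)"
  proof (cases "\<exists>p. prime p \<and> p dvd n \<and> Y ^ 5 < real p")
    case True
    then obtain p where p: "prime p" "p dvd n" "Y ^ 5 < real p" by blast
    \<comment> \<open>The codivisor of the gcd is smaller than \<open>p\<close>, so \<open>p\<close>
      must divide the gcd; the single element \<open>p\<close> suffices.\<close>
    have "p dvd x" if "x \<in> U" for x
    proof -
      define m where "m = n div gcd x n"
      have nm: "n = m * gcd x n" by (simp add: m_def)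
      have "m > 0" using n nm by (auto intro: gr0I)
      moreover have "real m < real p" using m_less[of x] that p(3) by (simp add: U_def m_def)
      ultimately have "\<not> p dvd m" using dvd_imp_le[of p m] by auto
      moreover have "p dvd m * gcd x n" using p(2) nm by simp
      ultimately have "p dvd gcd x n" using p(1) prime_dvd_mult_iff by blast
      then show ?thesis by simp
    qed
    moreover have "Y ^ 4 \<le> Y ^ 5" using Y by (intro power_increasing) auto
    ultimately show ?thesis using p(3) X(4) by (intro exI[of _ "{p}"]) auto
  next
    case False
    \<comment> \<open>The factor 10 gives \<open>2 ^ r \<ge> Y ^ 5\<close> by
      \<open>ln 2 \<ge> 1/2\<close>, so every codivisor is below \<open>2 ^ r\<close>. With
      \<open>t = Y ^ 4\<close> and \<open>T = Y ^ 5\<close>, the requirement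
      \<open>Y ^ (9 * r) \<le> n\<close> follows from \<open>9 * 11 \<le> 100\<close>.\<close>
    define r where "r = nat \<lceil>10 * ln Y\<rceil>"
    have r: "10 * ln Y \<le> real r" "real r \<le> 11 * ln Y"
      using lnY unfolding r_def by linarith+
    have "real (9 * r) * ln Y \<le> 99 * (ln Y)\<^sup>2"
      using mult_right_mono[OF r(2), of "ln Y"] lnY by (simp add: power2_eq_square)
    also have "\<dots> \<le> ln (real n)"
      using assms(4) zero_le_power2[of "ln Y"] unfolding Y_def[symmetric] by linarith
    finally have "ln (Y ^ (9 * r)) \<le> ln (real n)" using Y by (subst ln_realpow) auto
    then have "Y ^ (9 * r) \<le> real n" using Y n by (subst (asm) ln_le_cancel_iff) auto
    then have "(Y ^ 4 * Y ^ 5) ^ r \<le> real n" by (simp flip: power_add power_mult)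
    then obtain E where E: "finite E" "card E \<le> r" "\<And>e. e \<in> E \<Longrightarrow> Y ^ 4 \<le> real e"
      "\<And>m. m dvd n \<Longrightarrow> m < 2 ^ r \<Longrightarrow> \<exists>e\<in>E. e dvd n div m"
      using exists_divisors_dividing_codivisors[of n "Y ^ 4" "Y ^ 5" r] n Y False
      by (auto simp: one_le_power not_less)
    have "5 * ln Y \<le> real r * (1/2)" using r by simp
    also have "\<dots> \<le> real r * ln 2" using ln_le_minus_one[of "1/2::real"] by (intro mult_left_mono) (auto simp: ln_div)
    finally have "ln (Y ^ 5) \<le> ln (2 ^ r)" using Y by (simp add: ln_realpow)
    then have Y5: "Y ^ 5 \<le> 2 ^ r" using Y by (subst (asm) ln_le_cancel_iff) auto
    have "\<exists>e\<in>E. e dvd x" if x: "x \<in> U" for x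
    proof -
      have "real (n div gcd x n) < Y ^ 5" using m_less[of x] x by (simp add: U_def)
      also have "\<dots> \<le> real (2 ^ r)" using Y5 by simp
      finally have "real (n div gcd x n) < real (2 ^ r)" .
      then have "n div gcd x n < 2 ^ r" by (simp only: of_nat_less_iff)
      moreover have "n div gcd x n dvd n" by (rule dvdI[of _ _ "gcd x n"]) simp
      ultimately obtain e where "e \<in> E" "e dvd n div (n div gcd x n)" using E(4) by blast
      moreover have "n div (n div gcd x n) = gcd x n" using n by (simp add: div_div_eq_right)
      ultimately show ?thesis by (metis dvd_trans gcd_dvd1)
    qed
    moreover have "real r \<le> ln (real n)"
    proof -
      have "ln Y * 1 \<le> ln Y * ln Y" using lnY by (intro mult_left_mono) auto
      then show ?thesis using r(2) assms(4) lnY unfolding Y_def[symmetric] power2_eq_square by linarith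
    qed
    then have "real (card E) \<le> X" using E(2) X(3) by linarith
    ultimately show ?thesis using E(1,3) by blast
  qed
  then obtain E where E: "finite E" "real (card E) \<le> X" "\<And>e. e \<in> E \<Longrightarrow> Y ^ 4 \<le> real e"
    "\<And>x. x \<in> U \<Longrightarrow> \<exists>e\<in>E. e dvd x" by blast
  have "covers n l (E \<inter> {..<n}) U"
    using E(3,4) big by (intro covers_divisors) (auto simp: U_def)
  moreover have "card (E \<inter> {..<n}) \<le> card E" using E(1) by (intro card_mono) auto
  then have "real (card (E \<inter> {..<n})) \<le> X" using E(2) by linarith
  ultimately show ?thesis unfolding U_def X_def Y_def by blast
qed

theorem mainTheorem11:
  shows "\<exists>C::real. C > 0 \<and>
    (\<forall>n l :: nat. 2 \<le> n \<longrightarrow> 1 \<le> l \<longrightarrow> l < n \<longrightarrow>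
       (\<exists>B. covering_set n l B \<and> real (card B) \<le> C * real n * logc (real n) / real l))"
proof -
  obtain l0 where l0: "\<And>l n. l \<ge> l0 \<Longrightarrow> n > 0 \<Longrightarrow> 8 * ln (real n) \<le> real l \<Longrightarrow>
     real l / (8 * ln (real l)) \<le> real (card {p. prime p \<and> p \<le> l \<and> \<not> p dvd n})"
    using eventually_card_primes_not_dvd_ge by blast
  obtain n0 where n0: "\<And>n. n \<ge> n0 \<Longrightarrow> 100 * (ln (sieve_bound n ^ 4))\<^sup>2 \<le> ln (real n)"
    using eventually_ln_sieve_bound_le by blast
  \<comment> \<open>\<open>l > c\<close> gives \<open>l \<ge> l0\<close>, \<open>n \<ge> n0\<close>
    and \<open>ln l \<ge> 2\<close>; the 12 also dominates the constants 8, 11 and 4 + 4 of the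
    cases below.\<close>
  define c where "c = l0 + n0 + 12"
  have *: "\<exists>B. covers n l B {x. 0 < x \<and> x < n} \<and> real (card B) \<le> real c * (real n * logc (real n) / real l)"
    if l: "1 \<le> l" "l < n" for n l
  proof -
    define X where "X = real n * logc (real n) / real l"
    note X = target_size_ge[OF l(2,1), folded X_def]
    have cX: "11 * X \<le> real c * X" using X(4) by (intro mult_right_mono) (auto simp: c_def)
    have n: "n > 0" using l by simp
    define Y where "Y = sieve_bound n ^ 4"
    have "2 ^ 4 \<le> Y" unfolding Y_def by (intro power_mono sieve_bound_ge_2) auto
    then have Y: "Y \<ge> 16" by simp
    consider "l \<le> c \<or> real l < 8 * ln (real n)" | "l > c" "8 * ln (real n) \<le> real l" by linarith
    then have "\<exists>B. covers n l B {x. 0 < x \<and> x < n} \<and> real (card B) \<le> real c * X"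
    proof cases
      case 1
      have "covers n l {..<n} {x. 0 < x \<and> x < n}"
        using self_in_multiples[OF _ l(1), of _ n] by (auto simp: covers_def)
      moreover have "real n \<le> real c * X"
        using 1
      proof
        assume "l \<le> c"
        have "real n = real l * (real n / real l)" using l by simp
        also have "\<dots> \<le> real c * X" using \<open>l \<le> c\<close> X(1) by (intro mult_mono) auto
        finally show ?thesis .
      next
        assume lt: "real l < 8 * ln (real n)"
        have "real n = real n / real l * real l" using l by simp
        also have "\<dots> \<le> real n / real l * (8 * ln (real n))" using lt by (intro mult_left_mono) auto
        also have "\<dots> = 8 * (real n / real l * ln (real n))" by simp
        also have "\<dots> \<le> 8 * X" using X(5) by linarith
        also have "\<dots> \<le> real c * X" using cX X(4) by linarith
        finally show ?thesis .
      qed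
      ultimately show ?thesis by (intro exI[of _ "{..<n}"]) simp
    next
      case 2
      have asym: "100 * (ln Y)\<^sup>2 \<le> ln (real n)" using n0[of n] l 2 by (simp add: Y_def c_def)
      show ?thesis
      \<comment> \<open>Below this threshold \<open>ln l \<le> 2 * ln Y\<close>, so the square of
        \<open>ln l\<close> is at most \<open>ln n\<close>; with \<open>ln l \<ge> 2\<close> this
        also yields \<open>l * l \<le> n\<close>.\<close>
      proof (cases "real l < Y\<^sup>2")
        case True
        have "exp 2 = exp 1 * exp (1::real)" by (simp flip: exp_add)
        also have "\<dots> \<le> 3 * 3" using exp_le by (intro mult_mono) auto
        finally have "exp 2 \<le> real l" using 2(1) by (simp add: c_def)
        then have ln2: "2 \<le> ln (real l)" using l by (subst ln_ge_iff) auto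
        have "ln (real l) \<le> ln (Y\<^sup>2)" using True l by (subst ln_le_cancel_iff) auto
        then have "ln (real l) \<le> 2 * ln Y" using Y by (simp add: ln_realpow)
        then have "(ln (real l))\<^sup>2 \<le> (2 * ln Y)\<^sup>2" using ln2 by (intro power_mono) auto
        then have "(ln (real l))\<^sup>2 \<le> 4 * (ln Y)\<^sup>2" by (simp add: power_mult_distrib)
        also have "\<dots> \<le> 100 * (ln Y)\<^sup>2" by (intro mult_right_mono) auto
        also note asym
        finally have sq: "(ln (real l))\<^sup>2 \<le> ln (real n)" .
        have "2 * ln (real l) \<le> ln (real l) * ln (real l)" using ln2 by (intro mult_right_mono) auto
        then have "ln (real (l * l)) \<le> ln (real n)" using sq l by (simp add: ln_mult power2_eq_square)
        then have "real (l * l) \<le> real n" using l n by (subst (asm) ln_le_cancel_iff) auto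
        then have "l * l \<le> n" by (simp only: of_nat_le_iff)
        then show ?thesis
          using cover_small_l[of l n] sq l0[of l n] 2 n cX by (fastforce simp: c_def X_def)
      next
        case False
        obtain B1 where B1: "covers n l B1 {x. 0 < x \<and> x < n \<and> real (gcd x n) * Y \<le> real l}"
          "real (card B1) \<le> 2 * real n / real l * ln (real l) + 2 * real n / real l"
          using cover_by_units[OF l] unfolding Y_def by blast
        have cB1: "real (card B1) \<le> 4 * X" using B1(2) X(1,2) by simp
        obtain B2 where B2: "covers n l B2 {x. 0 < x \<and> x < n \<and> real l < real (gcd x n) * Y}"
          "real (card B2) \<le> 4 * X"
        proof (cases "Y ^ 4 \<le> real n / real l")
          case True
          then show ?thesis
            using cover_large_gcd_large_quotient[OF l] False that unfolding Y_def X_def by force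
        next
          case F: False
          then obtain B where "covers n l B {x. 0 < x \<and> x < n \<and> real l < real (gcd x n) * Y}" "real (card B) \<le> X"
            using cover_large_gcd_small_quotient[OF l] asym unfolding Y_def X_def by force
          then show ?thesis using that X(4) by force
        qed
        have "real (card (B1 \<union> B2)) \<le> real c * X"
          using cB1 B2(2) card_Un_le[of B1 B2] cX X(4) by linarith
        moreover have "covers n l (B1 \<union> B2) {x. 0 < x \<and> x < n}"
          by (rule covers_mono[OF covers_Un[OF B1(1) B2(1)]]) auto
        ultimately show ?thesis by blast
      qed
    qed
    then show ?thesis by (simp add: X_def)
  qed
  have "\<exists>B. covering_set n l B \<and> real (card B) \<le> (real c + 1) * real n * logc (real n) / real l"
    if l: "1 \<le> l" "l < n" for n l
  proof -
    obtain B where B: "covers n l B {x. 0 < x \<and> x < n}" "real (card B) \<le> real c * (real n * logc (real n) / real l)"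
      using *[OF l] by blast
    \<comment> \<open>The element 0, whose gcd with \<open>n\<close> is \<open>n\<close>, was left
      out of the ranges above and costs one more element.\<close>
    have "covers n l {0} {0}" using self_in_multiples[of 0 n l] l by (auto simp: covers_def)
    then have "covers n l (B \<union> {0}) {..<n}" by (rule covers_mono[OF covers_Un[OF B(1)]]) auto
    then have "covering_set n l (B \<union> {0})" using l by (intro covers_imp_covering_set) auto
    moreover have "real (card (B \<union> {0})) \<le> real c * (real n * logc (real n) / real l) + real n * logc (real n) / real l"
      using card_Un_le[of B "{0}"] B(2) target_size_ge(4)[OF l(2,1)] by simp
    then have "real (card (B \<union> {0})) \<le> (real c + 1) * real n * logc (real n) / real l"
      by (simp add: algebra_simps add_divide_distrib)
    ultimately show ?thesis by blast
  qed
  then show ?thesis by (intro exI[of _ "real c + 1"]) auto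
qed

end
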